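(* Let $1\leq q<3$ and $a\in\mathbb{R}\setminus\{0\}$ be such that either $q=1$, or $q>1$ and $1-a<\frac{q}{q-1}$. For $\xi\in\mathbb{R}\times\Sigma_{q,a}$ and $s,t\in\{\mu,\sigma\}$, the assignment $$g^{(q,a)}\Big(\frac{\partial}{\partial s},\frac{\partial}{\partial t}\Big)(p_q(\cdot;\xi)):=g^{(q,a)}_{st}(\xi)$$ determines a Riemannian metric on $\mathcal{S}_{q,a}$, where $$g^{(q,a)}_{st}(\xi):=\int_{\mathbb{R}}\frac{\partial}{\partial s}\ln_{q,a}(p_q(x;\xi))\cdot\frac{\partial}{\partial t}\ln_{q,a}(p_q(x;\xi))\cdot\exp_{q,a}''\big(\ln_{q,a}(p_q(x;\xi))\big)\,dx .$$
   Context: The $q$-logarithm is $\ln_q(t):=\int_1^t s^{-q}\,ds$ for $t\in(0,\infty)$, and $\exp_q$ denotes the inverse function of $\ln_q:(0,\infty)\to\ln_q(0,\infty)$. The $a$-refined $q$-logarithm $\ln_{q,a}:(0,1)\to\mathbb{R}$ is $\ln_{q,a}(t):=-\frac1a(-\ln_q(t))^a$ (strictly increasing), and $\exp_{q,a}:\ln_{q,a}(0,1)\to(0,1)$ is its inverse. Put $Z_q:=\sqrt{3-q}\int_{\mathbb{R}}\exp_q(-x^2)\,dx$ (so $Z_1=\sqrt{2\pi}$, and $Z_q=\sqrt{\frac{3-q}{q-1}}\,B\big(\frac{3-q}{2(q-1)},\frac12\big)$ for $1<q<3$, where $B$ is the beta function). For $\xi=(\mu,\sigma)\in\mathbb{R}\times(0,\infty)$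 the $q$-Gaussian density is $$p_q(x;\xi)=\frac{1}{Z_q\sigma}\exp_q\!\Big(-\frac{1}{3-q}\Big(\frac{x-\mu}{\sigma}\Big)^2\Big),\qquad x\in\mathbb{R}.$$ Under the stated condition on $(q,a)$ set $T_{q,a}:=1/\exp_q\big(\max\{0,\frac{1-a}{q}\}\big)\in(0,1]$, $\Sigma_{q,a}:=\{\sigma>0:\frac{1}{Z_q\sigma}<T_{q,a}\}$, and $\mathcal{S}_{q,a}:=\{p_q(\cdot;\xi):\xi\in\mathbb{R}\times\Sigma_{q,a}\}$, regarded as a two-dimensional manifold with global coordinates $\xi=(\mu,\sigma)\in\mathbb{R}\times\Sigma_{q,a}$; $\partial/\partial\mu,\partial/\partial\sigma$ are the coordinate vector fields. *)

theory Defs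
  imports "HOL-Analysis.Analysis" "HOL-Library.FuncSet"
begin

subsection \<open>Refined logarithms and exponentials\<close>

definition ln_q :: "real \<Rightarrow> real \<Rightarrow> real" where
  "ln_q q t = (LBINT s=ereal 1..ereal t. s powr (- q))"

text \<open>The inverses below are meaningful only on \<open>ln_q q ` {0<..}\<close> and
  \<open>ln_qa q a ` {0<..<1}\<close>, respectively; elsewhere their values are unspecified.\<close>

definition exp_q :: "real \<Rightarrow> real \<Rightarrow> real" where
  "exp_q q = the_inv_into {0<..} (ln_q q)"

definition ln_qa :: "real \<Rightarrow> real \<Rightarrow> real \<Rightarrow> real" where
  "ln_qa q a t = - (1 / a) * (- ln_q q t) powr a"

definition exp_qa :: "real \<Rightarrow> real \<Rightarrow> real \<Rightarrow> real" where
  "exp_qa q a = the_inv_into {0<..<1} (ln_qa q a)"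

subsection \<open>The \<open>q\<close>-Gaussian densities\<close>

definition Z_q :: "real \<Rightarrow> real" where
  "Z_q q = sqrt (3 - q) * (LINT x|lborel. exp_q q (- (x\<^sup>2)))"

definition q_gaussian :: "real \<Rightarrow> real \<times> real \<Rightarrow> real \<Rightarrow> real" where
  "q_gaussian q \<xi> x = (case \<xi> of (\<mu>, \<sigma>) \<Rightarrow>
     1 / (Z_q q * \<sigma>) * exp_q q (- (1 / (3 - q)) * ((x - \<mu>) / \<sigma>)\<^sup>2))"

definition T_qa :: "real \<Rightarrow> real \<Rightarrow> real" where
  "T_qa q a = 1 / exp_q q (max 0 ((1 - a) / q))"

definition Sigma_qa :: "real \<Rightarrow> real \<Rightarrow> real set" where
  "Sigma_qa q a = {\<sigma>. \<sigma> > 0 \<and> 1 / (Z_q q * \<sigma>) < T_qa q a}"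

definition param_qa :: "real \<Rightarrow> real \<Rightarrow> (real \<times> real) set" where
  "param_qa q a = UNIV \<times> Sigma_qa q a"

definition S_qa :: "real \<Rightarrow> real \<Rightarrow> (real \<Rightarrow> real) set" where
  "S_qa q a = q_gaussian q ` param_qa q a"

subsection \<open>Coordinates and the coefficients of the metric\<close>

datatype coord = Mu | Sg

fun slice :: "coord \<Rightarrow> (real \<times> real \<Rightarrow> real) \<Rightarrow> real \<times> real \<Rightarrow> real \<Rightarrow> real" where
  "slice Mu f (\<mu>, \<sigma>) = (\<lambda>m. f (m, \<sigma>))"
| "slice Sg f (\<mu>, \<sigma>) = (\<lambda>s. f (\<mu>, s))"

fun coord_value :: "coord \<Rightarrow> real \<times> real \<Rightarrow> real" where
  "coord_value Mu (\<mu>, \<sigma>) = \<mu>"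
| "coord_value Sg (\<mu>, \<sigma>) = \<sigma>"

definition partial_differentiable :: "coord \<Rightarrow> (real \<times> real \<Rightarrow> real) \<Rightarrow> real \<times> real \<Rightarrow> bool" where
  "partial_differentiable c f \<xi> \<longleftrightarrow> slice c f \<xi> field_differentiable at (coord_value c \<xi>)"

definition partial_deriv :: "coord \<Rightarrow> (real \<times> real \<Rightarrow> real) \<Rightarrow> real \<times> real \<Rightarrow> real" where
  "partial_deriv c f \<xi> = deriv (slice c f \<xi>) (coord_value c \<xi>)"

text \<open>Tangent vectors are represented by their components in the global coordinates,
  so the coordinate vector fields are the standard basis vectors.\<close>

fun coord_field :: "coord \<Rightarrow> real \<times> real" where
  "coord_field Mu = (1, 0)"
| "coord_field Sg = (0, 1)"

definition g_integrand ::
  "real \<Rightarrow> real \<Rightarrow> coord \<Rightarrow> coord \<Rightarrow> real \<times> real \<Rightarrow> real \<Rightarrow> real" where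
  "g_integrand q a s t \<xi> x =
     partial_deriv s (\<lambda>\<eta>. ln_qa q a (q_gaussian q \<eta> x)) \<xi> *
     partial_deriv t (\<lambda>\<eta>. ln_qa q a (q_gaussian q \<eta> x)) \<xi> *
     (deriv ^^ 2) (exp_qa q a) (ln_qa q a (q_gaussian q \<xi> x))"

definition g_qa :: "real \<Rightarrow> real \<Rightarrow> coord \<Rightarrow> coord \<Rightarrow> real \<times> real \<Rightarrow> real" where
  "g_qa q a s t \<xi> = (LINT x|lborel. g_integrand q a s t \<xi> x)"

subsection \<open>Riemannian metrics on a manifold with a global chart\<close>

text \<open>Smoothness is intended for open sets. In finite dimensions, having directional
  derivatives of class \<open>C^k\<close> in every fixed direction (in addition to differentiability)
  amounts to the derivative being of class \<open>C^k\<close>.\<close>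

primrec Ck_on ::
  "nat \<Rightarrow> 'e::euclidean_space set \<Rightarrow> ('e \<Rightarrow> real) \<Rightarrow> bool" where
  "Ck_on 0 U f \<longleftrightarrow> continuous_on U f"
| "Ck_on (Suc k) U f \<longleftrightarrow> (\<forall>x\<in>U. f differentiable (at x)) \<and>
     (\<forall>v. Ck_on k U (\<lambda>x. frechet_derivative f (at x) v))"

definition smooth_on :: "'e::euclidean_space set \<Rightarrow> ('e \<Rightarrow> real) \<Rightarrow> bool" where
  "smooth_on U f \<longleftrightarrow> (\<forall>k. Ck_on k U f)"

text \<open>The manifold is \<open>\<phi> ` U\<close> with the inverse of \<open>\<phi>\<close> as its global chart. Each tangent
  space is identified with the coordinate space, and \<open>G p v w\<close> is the value of the metric
  at the point \<open>p\<close> on the tangent vectors with components \<open>v\<close> and \<open>w\<close>.\<close>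

definition riemannian_metric ::
  "'e::euclidean_space set \<Rightarrow> ('e \<Rightarrow> 'm) \<Rightarrow> ('m \<Rightarrow> 'e \<Rightarrow> 'e \<Rightarrow> real) \<Rightarrow> bool" where
  "riemannian_metric U \<phi> G \<longleftrightarrow>
     open U \<and> inj_on \<phi> U \<and>
     (\<forall>p\<in>\<phi> ` U. bilinear (G p) \<and> (\<forall>v w. G p v w = G p w v) \<and> (\<forall>v. v \<noteq> 0 \<longrightarrow> G p v v > 0)) \<and>
     (\<forall>v w. smooth_on U (\<lambda>\<xi>. G (\<phi> \<xi>) v w))"

end

theory Submission
  imports Defs
begin

text \<open>
  Put \<open>L = - ln_q p\<close>. Since \<open>ln_q (s * t) = ln_q s + s powr (1 - q) * ln_q t\<close>, for \<open>q\<close>-Gaussians \<open>L\<close> is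
  a quadratic polynomial in \<open>y = (x - \<mu>) / \<sigma>\<close>, and the partial derivatives of \<open>L\<close> are a common factor
  times the scores \<open>- 2 y / (3 - q)\<close> and \<open>1 - y\<^sup>2\<close>. The second derivative of \<open>exp_qa\<close> at \<open>ln_qa p\<close> is
  \<open>p powr q * L powr (1 - 2 * a) * (q * p powr (q - 1) * L - (1 - a))\<close>, whose last factor is positive
  precisely because \<open>p powr (q - 1) * L = ln_q (1 / p)\<close> and \<open>p < T_qa\<close>. Substituting \<open>y\<close>, every
  coefficient becomes \<open>1 / (Z * \<sigma>\<^sup>2)\<close> times
  \<open>\<integral> score_s * score_t * (q * e powr (2 * q - 1) - (1 - a) * (3 - q) * e powr q / (r + y\<^sup>2)) dy\<close>
  with the standard profile \<open>e(y)\<close> and \<open>r = (3 - q) * ln_q (Z * \<sigma>)\<close>. It is smooth because a Stieltjes-type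
  transform \<open>r \<mapsto> \<integral> w(y) / (r + y\<^sup>2) dy\<close> is smooth for \<open>r > 0\<close>, and the form is positive definite because
  the weight is positive and the scores are linearly independent polynomials.
\<close>

section \<open>The deformed logarithm and exponential\<close>

text \<open>This closed form is an antiderivative of \<open>s powr - q\<close> on the positive axis
  and vanishes at 1, so the fundamental theorem of calculus identifies it with the integral
  \<open>ln_q\<close>.\<close>

definition ln_q_formula :: "real \<Rightarrow> real \<Rightarrow> real" where
  "ln_q_formula q t = (if q = 1 then ln t else (t powr (1 - q) - 1) / (1 - q))"

lemma DERIV_ln_q_formula:
  assumes "t > 0"
  shows "(ln_q_formula q has_real_derivative t powr - q) (at t)"
proof (cases "q = 1")
  case True
  then have "ln_q_formula q = ln" by (auto simp: ln_q_formula_def)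
  then show ?thesis
    using assms True DERIV_ln[OF assms] by (simp add: powr_minus)
next
  case False
  then have "ln_q_formula q = (\<lambda>t. (t powr (1 - q) - 1) / (1 - q))"
    by (auto simp: ln_q_formula_def)
  moreover have "((\<lambda>t. (t powr (1 - q) - 1) / (1 - q)) has_real_derivative
      ((1 - q) * t powr (1 - q - 1) - 0) / (1 - q)) (at t)"
    using assms by (intro DERIV_cdivide DERIV_diff has_real_derivative_powr DERIV_const)
  ultimately show ?thesis using False by simp
qed

lemma ln_q_formula:
  assumes "t > 0"
  shows "ln_q q t = ln_q_formula q t"
proof -
  have "(LBINT s=ereal 1..ereal t. s powr - q) = ln_q_formula q t - ln_q_formula q 1"
  proof (rule interval_integral_FTC_finite)
    show "continuous_on {min 1 t..max 1 t} (\<lambda>s. s powr - q)"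
      using assms by (intro continuous_intros) auto
  next
    fix x assume "min 1 t \<le> x" "x \<le> max 1 t"
    then have "x > 0" using assms by auto
    then show "(ln_q_formula q has_vector_derivative x powr - q) (at x within {min 1 t..max 1 t})"
      using has_field_derivative_at_within[OF DERIV_ln_q_formula]
        has_real_derivative_iff_has_vector_derivative by blast
  qed
  then show ?thesis by (simp add: ln_q_def ln_q_formula_def)
qed

lemmas ln_q_eq = ln_q_formula[unfolded ln_q_formula_def]

lemma DERIV_ln_q:
  assumes "t > 0"
  shows "(ln_q q has_real_derivative t powr - q) (at t)"
  using DERIV_ln_q_formula[OF assms] open_greaterThan[of 0]
  by (rule has_field_derivative_transform_within_open) (use assms in \<open>auto simp: ln_q_formula\<close>)

lemma ln_q_1 [simp]: "ln_q q 1 = 0"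
  by (simp add: ln_q_eq)

lemma ln_q_less:
  assumes "0 < s" "s < t"
  shows "ln_q q s < ln_q q t"
  by (rule DERIV_pos_imp_increasing[OF assms(2)])
     (use assms in \<open>force intro!: exI DERIV_ln_q\<close>)

lemma inj_on_ln_q: "inj_on (ln_q q) {0<..}"
  by (rule inj_onI) (metis greaterThan_iff ln_q_less less_irrefl linorder_cases)

lemma ln_q_neg: "0 < t \<Longrightarrow> t < 1 \<Longrightarrow> ln_q q t < 0"
  using ln_q_less[of t 1] by simp

lemma ln_q_neg_iff: "0 < t \<Longrightarrow> ln_q q t < 0 \<longleftrightarrow> t < 1"
  using ln_q_less[of t 1 q] ln_q_less[of 1 t q] by (cases t "1::real" rule: linorder_cases) auto

lemma ln_q_mult:
  assumes "0 < s" "0 < t"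
  shows "ln_q q (s * t) = ln_q q s + s powr (1 - q) * ln_q q t"
proof (cases "q = 1")
  case True
  then show ?thesis using assms by (simp add: ln_q_eq ln_mult)
next
  case False
  have "(s powr (1 - q) * t powr (1 - q) - 1) / (1 - q)
      = (s powr (1 - q) - 1 + s powr (1 - q) * (t powr (1 - q) - 1)) / (1 - q)"
    by (simp add: algebra_simps)
  then show ?thesis using assms False by (simp add: ln_q_eq powr_mult add_divide_distrib)
qed

text \<open>The hypothesis says exactly that \<open>u\<close> lies in the range of
  \<open>ln_q q\<close> on the positive axis, where \<open>the_inv_into\<close> has a meaningful
  value; for \<open>q = 1\<close> it holds for every \<open>u\<close>.\<close>

lemma exp_q_eq:
  assumes "1 + (1 - q) * u > 0"
  shows "exp_q q u = (if q = 1 then exp u else (1 + (1 - q) * u) powr (1 / (1 - q)))" (is "_ = ?e")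
  unfolding exp_q_def
proof (rule the_inv_into_f_eq)
  show "inj_on (ln_q q) {0<..}" by (rule inj_on_ln_q)
  show "?e \<in> {0<..}" using assms by auto
  show "ln_q q ?e = u"
    using assms by (auto simp: ln_q_eq powr_powr)
qed

lemma exp_q_0 [simp]: "exp_q q 0 = 1"
  by (simp add: exp_q_eq)

lemma exp_q_pos: "1 + (1 - q) * u > 0 \<Longrightarrow> exp_q q u > 0"
  by (simp add: exp_q_eq)

lemma ln_q_exp_q: "1 + (1 - q) * u > 0 \<Longrightarrow> ln_q q (exp_q q u) = u"
  by (auto simp: exp_q_eq ln_q_eq powr_powr)

lemma exp_q_ln_q: "t > 0 \<Longrightarrow> exp_q q (ln_q q t) = t"
  unfolding exp_q_def by (simp add: the_inv_into_f_f[OF inj_on_ln_q])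

lemma exp_q_domain_nonpos:
  fixes q u :: real
  assumes "1 \<le> q" "u \<le> 0"
  shows "1 + (1 - q) * u > 0"
proof -
  have "(1 - q) * u \<ge> 0" using assms by (simp add: mult_nonpos_nonpos)
  then show ?thesis by simp
qed

lemma exp_q_powr:
  assumes "1 + (1 - q) * u > 0"
  shows "exp_q q u powr (1 - q) = 1 + (1 - q) * u"
  using assms by (auto simp: exp_q_eq powr_powr)

lemma exp_q_less_1:
  assumes "1 \<le> q" "u < 0"
  shows "exp_q q u < 1"
proof -
  have d: "1 + (1 - q) * u > 0" using exp_q_domain_nonpos[of q u] assms by simp
  show ?thesis
    using ln_q_neg_iff[OF exp_q_pos[OF d], of q] ln_q_exp_q[OF d] assms(2) by simp
qed

lemma exp_q_le_1:
  assumes "1 \<le> q" "u \<le> 0"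
  shows "exp_q q u \<le> 1"
  using exp_q_less_1[OF assms(1), of u] assms by (cases "u = 0") auto

text \<open>This is the inverse function rule for \<open>ln_q\<close>, whose derivative is
  \<open>t powr - q\<close>. Expressing the result through \<open>exp_q q u\<close> itself avoids
  any later case distinction on \<open>q\<close>.\<close>

lemma DERIV_exp_q:
  assumes u: "1 + (1 - q) * u > 0"
  shows "(exp_q q has_real_derivative exp_q q u powr q) (at u)"
proof -
  let ?S = "{u. 1 + (1 - q) * u > 0}"
  have S: "open ?S" by (intro open_Collect_less continuous_intros)
  have "((\<lambda>u. if q = 1 then exp u else (1 + (1 - q) * u) powr (1 / (1 - q)))
      has_real_derivative exp_q q u powr q) (at u)"
  proof (cases "q = 1")
    case True
    then show ?thesis by (auto intro!: derivative_eq_intros simp: exp_q_eq)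
  next
    case False
    then have e: "1 / (1 - q) - 1 = q / (1 - q)" by (simp add: field_simps)
    have "((\<lambda>u. (1 + (1 - q) * u) powr (1 / (1 - q)))
      has_real_derivative (1 + (1 - q) * u) powr (1 / (1 - q) - 1)) (at u)"
      using u False by (auto intro!: derivative_eq_intros simp: field_simps powr_diff)
    then show ?thesis using u False by (simp add: exp_q_eq powr_powr e)
  qed
  then show ?thesis
    by (rule has_field_derivative_transform_within_open[OF _ S]) (use u in \<open>auto simp: exp_q_eq\<close>)
qed

lemma continuous_on_exp_q_quadratic:
  assumes "1 \<le> q" "0 \<le> c"
  shows "continuous_on UNIV (\<lambda>x. exp_q q (- (c * x\<^sup>2)))"
proof (rule continuous_on_compose2[of "{..0}" "exp_q q"])
  show "continuous_on {..0} (exp_q q)"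
    using DERIV_exp_q[OF exp_q_domain_nonpos[OF assms(1)]]
    by (intro DERIV_continuous_on) (auto intro: has_field_derivative_at_within)
qed (use assms in \<open>auto intro!: continuous_intros\<close>)

section \<open>The refined logarithm and exponential\<close>

lemma inj_on_ln_qa:
  assumes "a \<noteq> 0"
  shows "inj_on (ln_qa q a) {0<..<1}"
proof (rule inj_onI)
  fix s t :: real assume st: "s \<in> {0<..<1}" "t \<in> {0<..<1}" and eq: "ln_qa q a s = ln_qa q a t"
  have p: "- ln_q q s > 0" "- ln_q q t > 0" using st by (auto simp: ln_q_neg)
  from eq have "(- ln_q q s) powr a = (- ln_q q t) powr a"
    using assms by (simp add: ln_qa_def)
  then have "((- ln_q q s) powr a) powr (1 / a) = ((- ln_q q t) powr a) powr (1 / a)" by simp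
  then have "ln_q q s = ln_q q t" using p assms by (simp add: powr_powr)
  then show "s = t" using inj_on_ln_q[of q] st by (auto dest: inj_onD)
qed

lemma ln_qa_range:
  assumes "a \<noteq> 0" "0 < t" "t < 1"
  shows "a * ln_qa q a t < 0"
  using assms ln_q_neg[of t q] by (simp add: ln_qa_def)

lemma ln_qa_arg:
  assumes "a \<noteq> 0" "0 < t" "t < 1"
  shows "(- (a * ln_qa q a t)) powr (1 / a) = - ln_q q t"
  using assms ln_q_neg[of t q] by (simp add: ln_qa_def powr_powr)

text \<open>With \<open>L = - ln_q q t\<close>, the equation \<open>u = - (1 / a) * L powr a\<close>
  is solved by \<open>L = (- (a * u)) powr (1 / a)\<close>. As \<open>q \<ge> 1\<close>, every
  positive \<open>L\<close> occurs, so \<open>a * u < 0\<close> describes the whole range of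
  \<open>ln_qa\<close> on the unit interval.\<close>

lemma exp_qa_eq:
  assumes q: "1 \<le> q" and a: "a \<noteq> 0" and u: "a * u < 0"
  shows "exp_qa q a u = exp_q q (- ((- (a * u)) powr (1 / a)))"
  unfolding exp_qa_def
proof (rule the_inv_into_f_eq)
  let ?L = "(- (a * u)) powr (1 / a)"
  have L: "?L > 0" using u by auto
  have d: "1 + (1 - q) * - ?L > 0" using L by (intro exp_q_domain_nonpos[OF q]) simp
  show "inj_on (ln_qa q a) {0<..<1}" by (rule inj_on_ln_qa[OF a])
  show "exp_q q (- ?L) \<in> {0<..<1}"
    using exp_q_pos[OF d] exp_q_less_1[OF q, of "- ?L"] L by auto
  show "ln_qa q a (exp_q q (- ?L)) = u"
    using ln_q_exp_q[OF d] a u by (simp add: ln_qa_def powr_powr)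
qed

text \<open>The inner function satisfies \<open>L' = - L powr (1 - a)\<close>, and
  \<open>exp_q\<close> satisfies the equation \<open>e' = e powr q\<close>; the chain and product
  rules give the rest. In the second derivative only the last factor can fail to be
  positive.\<close>

lemma DERIV_exp_qa:
  fixes q a :: real
  defines "L \<equiv> \<lambda>u. (- (a * u)) powr (1 / a)"
  assumes q: "1 \<le> q" and a: "a \<noteq> 0" and u: "a * u < 0"
  shows "(exp_qa q a has_real_derivative
           exp_q q (- L u) powr q * L u powr (1 - a)) (at u)" (is ?D1)
    and "(deriv (exp_qa q a) has_real_derivative
           exp_q q (- L u) powr q * L u powr (1 - 2 * a) *
           (q * exp_q q (- L u) powr (q - 1) * L u - (1 - a))) (at u)" (is ?D2)
proof -
  let ?S = "{u. a * u < 0}"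
  have S: "open ?S" by (intro open_Collect_less continuous_intros)
  have Lpos: "L u > 0" if "a * u < 0" for u using that by (auto simp: L_def)
  have d: "1 + (1 - q) * - L u > 0" if "a * u < 0" for u
    using Lpos[OF that] by (intro exp_q_domain_nonpos[OF q]) simp
  have dL: "(L has_real_derivative - (L u powr (1 - a))) (at u)" if "a * u < 0" for u
  proof -
    have e: "(1 - a) / a = 1 / a - 1" using a by (simp add: field_simps)
    have "(L has_real_derivative - ((- (a * u)) powr (1 / a - 1))) (at u)"
      unfolding L_def using that a by (auto intro!: derivative_eq_intros simp: field_simps powr_diff)
    then show ?thesis by (simp add: L_def powr_powr e)
  qed
  have E: "((\<lambda>u. exp_q q (- L u)) has_real_derivative exp_q q (- L u) powr q * L u powr (1 - a)) (at u)"
    if "a * u < 0" for u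
    using DERIV_chain2[OF DERIV_exp_q[OF d[OF that]] DERIV_minus[OF dL[OF that]]] by simp
  have D1: "(exp_qa q a has_real_derivative exp_q q (- L u) powr q * L u powr (1 - a)) (at u)"
    if "a * u < 0" for u
    using E[OF that]
    by (rule has_field_derivative_transform_within_open[OF _ S])
       (use that in \<open>auto simp: exp_qa_eq q a L_def\<close>)
  show ?D1 by (rule D1[OF u])
  define p where "p = exp_q q (- L u)"
  have p: "p > 0" unfolding p_def by (rule exp_q_pos[OF d[OF u]])
  have "((\<lambda>u. exp_q q (- L u) powr q * L u powr (1 - a)) has_real_derivative
      (p powr q * (q * p powr (q - 1) * (L u powr (1 - a) * L u powr (1 - a)))
        - p powr q * ((1 - a) * (L u powr (1 - a - 1) * L u powr (1 - a))))) (at u)"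
    using DERIV_mult[OF DERIV_fun_powr[OF E[OF u] p[unfolded p_def], of q]
        DERIV_fun_powr[OF dL[OF u] Lpos[OF u], of "1 - a"]]
    by (rule DERIV_cong) (simp add: p_def algebra_simps)
  also have "L u powr (1 - a) * L u powr (1 - a) = L u powr (1 - 2 * a) * L u"
    using Lpos[OF u] by (simp add: powr_diff powr_mult_base field_simps flip: powr_add)
  also have "L u powr (1 - a - 1) * L u powr (1 - a) = L u powr (1 - 2 * a)"
    by (simp flip: powr_add)
  finally have "((\<lambda>u. exp_q q (- L u) powr q * L u powr (1 - a)) has_real_derivative
      p powr q * L u powr (1 - 2 * a) * (q * p powr (q - 1) * L u - (1 - a))) (at u)"
    by (simp add: algebra_simps)
  \<comment> \<open>The formula for the first derivative holds on the whole open set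
    \<open>?S\<close>, so it may be differentiated in place of \<open>deriv\<close>.\<close>
  then show ?D2 unfolding p_def
    by (rule has_field_derivative_transform_within_open[OF _ S])
       (use u in \<open>auto simp: DERIV_imp_deriv[OF D1]\<close>)
qed

section \<open>Integrability\<close>

lemma integrable_powr_atLeast:
  fixes e :: real
  assumes "e < -1"
  shows "integrable lborel (\<lambda>x. x powr e * indicator {1..} x)"
proof (rule integrableI_nonneg)
  have "(\<integral>\<^sup>+x. ennreal (x powr e) * indicator {1..} x \<partial>lborel) = ennreal (0 - 1 powr (e + 1) / (e + 1))"
  proof (rule nn_integral_FTC_atLeast[where F = "\<lambda>x. x powr (e + 1) / (e + 1)"])
    show "DERIV (\<lambda>x. x powr (e + 1) / (e + 1)) x :> x powr e" if "1 \<le> x" for x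
      using that assms DERIV_cdivide[OF has_real_derivative_powr[of x "e + 1"], of "e + 1"] by simp
    have "((\<lambda>x::real. x powr (e + 1)) \<longlongrightarrow> 0) at_top"
      using assms by (intro tendsto_neg_powr filterlim_ident) auto
    then show "((\<lambda>x. x powr (e + 1) / (e + 1)) \<longlongrightarrow> 0) at_top"
      by (auto intro: tendsto_divide_zero)
  qed auto
  moreover have "ennreal (x powr e) * indicator {1..} x = ennreal (x powr e * indicator {1..} x)" for x
    by (auto split: split_indicator)
  ultimately show "(\<integral>\<^sup>+x. ennreal (x powr e * indicator {1..} x) \<partial>lborel) < \<infinity>"
    by simp
qed auto

text \<open>The function is at most 1 on \<open>[-1, 1]\<close> and at most a multiple of
  \<open>\<bar>x\<bar> powr (- 2 * s)\<close> outside, where the exponent is below -1.\<close>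

lemma integrable_quadratic_powr:
  fixes c s :: real
  assumes c: "c > 0" and s: "s > 1 / 2"
  shows "integrable lborel (\<lambda>x. (1 + c * x\<^sup>2) powr - s)"
proof -
  let ?h = "\<lambda>x::real. x powr (- 2 * s) * indicator {1..} x"
  have h: "integrable lborel ?h" using integrable_powr_atLeast[of "- 2 * s"] s by simp
  have h': "integrable lborel (\<lambda>x. ?h (- x))"
    using lborel_integrable_real_affine[OF h, of "-1" 0] by simp
  have i: "integrable lborel (indicator {-1..1} :: real \<Rightarrow> real)" by simp
  have "integrable lborel (\<lambda>x. indicator {-1..1} x + (c powr - s * ?h x + c powr - s * ?h (- x)))"
    using h h' i by (intro Bochner_Integration.integrable_add) (auto intro!: integrable_mult_right)
  then show ?thesis
  proof (rule Bochner_Integration.integrable_bound)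
    have "continuous_on UNIV (\<lambda>x::real. (1 + c * x\<^sup>2) powr - s)"
      using c by (intro continuous_intros) (auto simp: add_nonneg_eq_0_iff)
    then show "(\<lambda>x. (1 + c * x\<^sup>2) powr - s) \<in> borel_measurable lborel"
      by (simp add: borel_measurable_continuous_onI)
    have *: "(1 + c * x\<^sup>2) powr - s \<le> c powr - s * \<bar>x\<bar> powr (- 2 * s)" if "1 \<le> \<bar>x\<bar>" for x
    proof -
      have "(1 + c * x\<^sup>2) powr - s \<le> (c * x\<^sup>2) powr - s"
        using that c s by (intro powr_mono2') auto
      also have "(c * x\<^sup>2) powr - s = c powr - s * \<bar>x\<bar> powr (- 2 * s)"
      proof -
        have "x\<^sup>2 = \<bar>x\<bar> powr 2" using that by simp
        then show ?thesis using c by (simp only: powr_mult powr_powr) simp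
      qed
      finally show ?thesis .
    qed
    have "(1 + c * x\<^sup>2) powr - s \<le> indicator {-1..1} x + (c powr - s * ?h x + c powr - s * ?h (- x))" for x
    proof (cases "\<bar>x\<bar> \<le> 1")
      case True
      have "(1 + c * x\<^sup>2) powr - s \<le> 1 powr - s"
        using c s by (intro powr_mono2') auto
      then show ?thesis using True by (auto simp: abs_le_iff intro!: add_increasing2)
    next
      case False
      then show ?thesis using *[of x] by (auto simp: abs_if split: split_indicator if_splits)
    qed
    then show "AE x in lborel. norm ((1 + c * x\<^sup>2) powr - s)
        \<le> norm (indicator {-1..1} x + (c powr - s * ?h x + c powr - s * ?h (- x)))"
      by (intro AE_I2) (simp add: abs_of_nonneg)
  qed
qed

text \<open>For \<open>q = 1\<close> the Gaussian lies below a Cauchy profile, because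
  \<open>1 + u \<le> exp u\<close>. For \<open>q > 1\<close> the function is itself a negative power
  of a quadratic polynomial.\<close>

lemma integrable_exp_q_quadratic:
  assumes q: "1 \<le> q" "q < 3" and c: "c > 0"
  shows "integrable lborel (\<lambda>x. exp_q q (- (c * x\<^sup>2)))"
proof (cases "q = 1")
  case True
  have *: "exp (- (c * x\<^sup>2)) \<le> (1 + c * x\<^sup>2) powr - 1" for x
  proof -
    have "1 + c * x\<^sup>2 \<le> exp (c * x\<^sup>2)" by (rule exp_ge_add_one_self)
    moreover have "1 + c * x\<^sup>2 > 0" using c by (simp add: add_pos_nonneg)
    ultimately show ?thesis by (simp add: exp_minus powr_minus le_imp_inverse_le)
  qed
  show ?thesis
    by (rule Bochner_Integration.integrable_bound[OF integrable_quadratic_powr[of c 1]])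
       (use c * True in \<open>auto simp: exp_q_eq\<close>)
next
  case False
  \<comment> \<open>The bound \<open>q < 3\<close> is precisely what makes this exponent large
    enough for convergence.\<close>
  have "1 / (q - 1) > 1 / 2" using q False by (simp add: field_simps)
  then have "integrable lborel (\<lambda>x. (1 + (q - 1) * c * x\<^sup>2) powr - (1 / (q - 1)))"
    using q False c by (intro integrable_quadratic_powr) auto
  moreover have "exp_q q (- (c * x\<^sup>2)) = (1 + (q - 1) * c * x\<^sup>2) powr - (1 / (q - 1))" for x
  proof -
    have "1 / (1 - q) = - (1 / (q - 1))" using False by (simp add: field_simps)
    moreover have "1 + (1 - q) * - (c * x\<^sup>2) = 1 + (q - 1) * c * x\<^sup>2" by (simp add: algebra_simps)
    ultimately show ?thesis
      using exp_q_eq[OF exp_q_domain_nonpos[of q "- (c * x\<^sup>2)"]] q c False by simp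
  qed
  ultimately show ?thesis by simp
qed

section \<open>Moments of powers of the deformed Gaussian\<close>

lemma one_plus_quadratic_le:
  fixes x k :: real
  assumes k: "k > 0"
  shows "1 + x\<^sup>2 \<le> max 1 (1 / k) * (1 + k * x\<^sup>2)"
proof -
  have "x\<^sup>2 = (1 / k) * (k * x\<^sup>2)" using k by simp
  also have "\<dots> \<le> max 1 (1 / k) * (k * x\<^sup>2)" using k by (intro mult_right_mono) auto
  finally show ?thesis unfolding distrib_left mult_1_right by (intro add_mono) auto
qed

text \<open>Half of the exponent is spent on absorbing the polynomial factor.\<close>

lemma gauss_moment_le:
  fixes c x :: real
  assumes c: "c > 0"
  shows "exp (- (c * x\<^sup>2)) * (1 + x\<^sup>2) \<le> max 1 (2 / c) * exp (- (c / 2 * x\<^sup>2))"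
proof -
  have "1 + x\<^sup>2 \<le> max 1 (1 / (c / 2)) * (1 + c / 2 * x\<^sup>2)"
    using c by (intro one_plus_quadratic_le) auto
  also have "\<dots> \<le> max 1 (1 / (c / 2)) * exp (c / 2 * x\<^sup>2)"
    using exp_ge_add_one_self[of "c / 2 * x\<^sup>2"] by (intro mult_left_mono) auto
  finally have "exp (- (c * x\<^sup>2)) * (1 + x\<^sup>2)
      \<le> exp (- (c * x\<^sup>2)) * (max 1 (2 / c) * exp (c / 2 * x\<^sup>2))"
    by (intro mult_left_mono) auto
  also have "\<dots> = max 1 (2 / c) * exp (- (c * x\<^sup>2) + c / 2 * x\<^sup>2)"
    by (simp only: exp_add mult_ac)
  also have "- (c * x\<^sup>2) + c / 2 * x\<^sup>2 = - (c / 2 * x\<^sup>2)" by (simp add: field_simps)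
  finally show ?thesis .
qed

text \<open>The power \<open>q - 1\<close> of the profile is exactly the reciprocal of
  \<open>1 + (q - 1) * c * x\<^sup>2\<close>, so it absorbs one factor
  \<open>1 + x\<^sup>2\<close>.\<close>

lemma exp_q_powr_moment_le:
  fixes c x q :: real
  assumes q: "1 < q" and c: "c > 0"
  shows "exp_q q (- (c * x\<^sup>2)) powr (q - 1) * (1 + x\<^sup>2) \<le> max 1 (1 / ((q - 1) * c))"
proof -
  let ?e = "exp_q q (- (c * x\<^sup>2))" and ?k = "(q - 1) * c"
  have k: "?k > 0" using q c by simp
  have d: "1 + (1 - q) * - (c * x\<^sup>2) > 0" using q c by (intro exp_q_domain_nonpos) auto
  have "?e powr (1 - q) = 1 + ?k * x\<^sup>2"
    using exp_q_powr[OF d] by (simp add: algebra_simps)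
  then have "?e powr (q - 1) = 1 / (1 + ?k * x\<^sup>2)"
    by (metis minus_diff_eq powr_minus_divide)
  moreover have "1 + ?k * x\<^sup>2 > 0" using k by (intro add_pos_nonneg) auto
  ultimately show ?thesis using one_plus_quadratic_le[OF k, of x] by (simp add: pos_divide_le_eq)
qed

lemma integrable_exp_q_quadratic_powr:
  assumes q: "1 \<le> q" "q < 3" and c: "c > 0"
  shows "integrable lborel (\<lambda>x. exp_q q (- (c * x\<^sup>2)) powr q * (1 + x\<^sup>2))"
proof -
  have meas: "(\<lambda>x. exp_q q (- (c * x\<^sup>2)) powr q * (1 + x\<^sup>2)) \<in> borel_measurable lborel"
    using borel_measurable_continuous_onI[OF continuous_on_exp_q_quadratic[of q c]] q c by simp
  \<comment> \<open>The rate \<open>d\<close> is left open to treat both cases alike: it is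
    \<open>c / 2\<close> for \<open>q = 1\<close>, where decay is traded for the polynomial factor,
    and \<open>c\<close> for \<open>q > 1\<close>.\<close>
  have "\<exists>d>0. \<exists>M. \<forall>x. exp_q q (- (c * x\<^sup>2)) powr q * (1 + x\<^sup>2) \<le> M * exp_q q (- (d * x\<^sup>2))"
  proof (cases "q = 1")
    case True
    then show ?thesis using c gauss_moment_le[OF c]
      by (intro exI[of _ "c / 2"] conjI exI[of _ "max 1 (2 / c)"]) (auto simp: exp_q_eq)
  next
    case False
    let ?M = "max 1 (1 / ((q - 1) * c))"
    have "exp_q q (- (c * x\<^sup>2)) powr q * (1 + x\<^sup>2) \<le> ?M * exp_q q (- (c * x\<^sup>2))" for x
    proof -
      let ?e = "exp_q q (- (c * x\<^sup>2))"
      have e: "?e > 0" using q c by (intro exp_q_pos exp_q_domain_nonpos) auto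
      have "?e powr q * (1 + x\<^sup>2) = ?e * (?e powr (q - 1) * (1 + x\<^sup>2))"
        using e by (simp add: powr_diff)
      also have "\<dots> \<le> ?e * ?M"
        using e exp_q_powr_moment_le[of q c x] q c False by (intro mult_left_mono) auto
      finally show ?thesis by (simp add: mult.commute)
    qed
    then show ?thesis using c by blast
  qed
  then obtain d M where "d > 0"
    and b: "\<And>x. exp_q q (- (c * x\<^sup>2)) powr q * (1 + x\<^sup>2) \<le> M * exp_q q (- (d * x\<^sup>2))"
    by blast
  have "integrable lborel (\<lambda>x. M * exp_q q (- (d * x\<^sup>2)))"
    using integrable_exp_q_quadratic[OF q \<open>d > 0\<close>] by (intro integrable_mult_right)
  then show ?thesis
    by (rule Bochner_Integration.integrable_bound)
       (use meas b in \<open>auto intro!: AE_I2 order_trans[OF _ abs_ge_self]\<close>)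
qed

text \<open>One factor \<open>1 + x\<^sup>2\<close> is absorbed as before, by the power
  \<open>q - 1\<close> or by half of the exponent; what remains is the previous lemma.\<close>

lemma integrable_exp_q_quadratic_powr2:
  assumes q: "1 \<le> q" "q < 3" and c: "c > 0"
  shows "integrable lborel (\<lambda>x. exp_q q (- (c * x\<^sup>2)) powr (2 * q - 1) * (1 + x\<^sup>2)\<^sup>2)"
proof -
  have meas: "(\<lambda>x. exp_q q (- (c * x\<^sup>2)) powr (2 * q - 1) * (1 + x\<^sup>2)\<^sup>2) \<in> borel_measurable lborel"
    using borel_measurable_continuous_onI[OF continuous_on_exp_q_quadratic[of q c]] q c by simp
  have "\<exists>d>0. \<exists>M. \<forall>x. exp_q q (- (c * x\<^sup>2)) powr (2 * q - 1) * (1 + x\<^sup>2)\<^sup>2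
      \<le> M * (exp_q q (- (d * x\<^sup>2)) powr q * (1 + x\<^sup>2))"
  proof (cases "q = 1")
    case True
    have "exp (- (c * x\<^sup>2)) * (1 + x\<^sup>2)\<^sup>2 \<le> max 1 (2 / c) * (exp (- (c / 2 * x\<^sup>2)) * (1 + x\<^sup>2))" for x
      using mult_right_mono[OF gauss_moment_le[OF c, of x], of "1 + x\<^sup>2"]
      by (simp add: power2_eq_square mult.assoc)
    then show ?thesis using c True
      by (intro exI[of _ "c / 2"] conjI exI[of _ "max 1 (2 / c)"]) (auto simp: exp_q_eq)
  next
    case False
    let ?M = "max 1 (1 / ((q - 1) * c))"
    have "exp_q q (- (c * x\<^sup>2)) powr (2 * q - 1) * (1 + x\<^sup>2)\<^sup>2
        \<le> ?M * (exp_q q (- (c * x\<^sup>2)) powr q * (1 + x\<^sup>2))" for x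
    proof -
      let ?e = "exp_q q (- (c * x\<^sup>2))"
      have "?e powr (2 * q - 1) = ?e powr (q - 1) * ?e powr q"
        by (simp flip: powr_add)
      then have "?e powr (2 * q - 1) * (1 + x\<^sup>2)\<^sup>2
          = (?e powr (q - 1) * (1 + x\<^sup>2)) * (?e powr q * (1 + x\<^sup>2))"
        by (simp add: power2_eq_square)
      also have "\<dots> \<le> ?M * (?e powr q * (1 + x\<^sup>2))"
        using exp_q_powr_moment_le[of q c x] q c False by (intro mult_right_mono) auto
      finally show ?thesis .
    qed
    then show ?thesis using c by blast
  qed
  then obtain d M where "d > 0"
    and b: "\<And>x. exp_q q (- (c * x\<^sup>2)) powr (2 * q - 1) * (1 + x\<^sup>2)\<^sup>2
        \<le> M * (exp_q q (- (d * x\<^sup>2)) powr q * (1 + x\<^sup>2))"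
    by blast
  have "integrable lborel (\<lambda>x. M * (exp_q q (- (d * x\<^sup>2)) powr q * (1 + x\<^sup>2)))"
    using integrable_exp_q_quadratic_powr[OF q \<open>d > 0\<close>] by (intro integrable_mult_right)
  then show ?thesis
    by (rule Bochner_Integration.integrable_bound)
       (use meas b in \<open>auto intro!: AE_I2 order_trans[OF _ abs_ge_self]\<close>)
qed

text \<open>A vanishing integral would make \<open>f\<close> zero almost everywhere, whereas its
  zero set is finite and hence null.\<close>

lemma integral_pos_finite_zeros:
  fixes f :: "real \<Rightarrow> real"
  assumes f: "integrable lborel f" and nonneg: "\<And>x. 0 \<le> f x" and fin: "finite {x. f x = 0}"
  shows "0 < (LINT x|lborel. f x)"
proof -
  have "(LINT x|lborel. f x) \<noteq> 0"
  proof
    assume "(LINT x|lborel. f x) = 0"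
    then have "AE x in lborel. f x = 0"
      using integral_nonneg_eq_0_iff_AE[OF f] nonneg by simp
    moreover have "AE x in lborel. x \<notin> {x. f x = 0}"
      using fin by (intro AE_not_in finite_imp_null_set_lborel)
    ultimately have "AE x in (lborel :: real measure). False" by eventually_elim simp
    then show False
      using ae_filter_eq_bot_iff[of "lborel :: real measure"] by (simp add: trivial_limit_def)
  qed
  moreover have "0 \<le> (LINT x|lborel. f x)" using nonneg by simp
  ultimately show ?thesis by simp
qed

section \<open>Smoothness in one real variable\<close>

text \<open>The metric coefficients depend on \<open>\<sigma>\<close> alone, so smoothness is proved
  in one variable and then transferred to \<open>Ck_on\<close>. Asking for some derivative
  \<open>f'\<close> instead of \<open>deriv f\<close> lets explicit formulas serve as
  witnesses.\<close>

primrec Ck_real :: "nat \<Rightarrow> real set \<Rightarrow> (real \<Rightarrow> real) \<Rightarrow> bool" where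
  "Ck_real 0 I f \<longleftrightarrow> continuous_on I f"
| "Ck_real (Suc k) I f \<longleftrightarrow>
     (\<exists>f'. (\<forall>s\<in>I. (f has_real_derivative f' s) (at s)) \<and> Ck_real k I f')"

lemma Ck_realI:
  assumes "\<And>s. s \<in> I \<Longrightarrow> (f has_real_derivative f' s) (at s)" "Ck_real k I f'"
  shows "Ck_real (Suc k) I f"
  using assms by auto

lemma Ck_real_Suc_imp: "Ck_real (Suc k) I f \<Longrightarrow> Ck_real k I f"
proof (induction k arbitrary: f)
  case 0
  then show ?case
    by (auto intro!: continuous_at_imp_continuous_on) (blast intro: DERIV_isCont)
next
  case (Suc k)
  then obtain f' where "\<forall>s\<in>I. (f has_real_derivative f' s) (at s)" "Ck_real (Suc k) I f'"
    by auto
  then show ?case using Suc.IH by auto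
qed

lemma Ck_real_cong:
  assumes "open I" "\<And>s. s \<in> I \<Longrightarrow> f s = g s" "Ck_real k I f"
  shows "Ck_real k I g"
proof (cases k)
  case 0
  have "continuous_on I f \<longleftrightarrow> continuous_on I g"
    using assms(2) by (rule continuous_on_cong[OF refl])
  then show ?thesis using assms(3) 0 by simp
next
  case (Suc n)
  then obtain f' where f': "\<And>s. s \<in> I \<Longrightarrow> (f has_real_derivative f' s) (at s)" "Ck_real n I f'"
    using assms(3) by auto
  have "(g has_real_derivative f' s) (at s)" if "s \<in> I" for s
    using f'(1)[OF that] assms(1) that assms(2) by (rule has_field_derivative_transform_within_open)
  then show ?thesis unfolding Suc using f'(2) by (rule Ck_realI)
qed

lemma Ck_real_const: "Ck_real k I (\<lambda>_. c)"
proof (induction k arbitrary: c)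
  case (Suc k)
  show ?case by (rule Ck_realI[OF _ Suc.IH[of 0]]) simp
qed simp

lemma Ck_real_ident: "Ck_real k I (\<lambda>s. s)"
proof (cases k)
  case (Suc n)
  show ?thesis unfolding Suc by (rule Ck_realI[OF DERIV_ident Ck_real_const])
qed simp

lemma Ck_real_add:
  "Ck_real k I f \<Longrightarrow> Ck_real k I g \<Longrightarrow> Ck_real k I (\<lambda>s. f s + g s)"
proof (induction k arbitrary: f g)
  case 0
  then show ?case by (auto intro: continuous_on_add)
next
  case (Suc k)
  then obtain f' g' where
    "\<forall>s\<in>I. (f has_real_derivative f' s) (at s)" "Ck_real k I f'"
    "\<forall>s\<in>I. (g has_real_derivative g' s) (at s)" "Ck_real k I g'"
    by auto
  then show ?case
    by (intro Ck_realI[where f' = "\<lambda>s. f' s + g' s"] Suc.IH) (auto intro: DERIV_add)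
qed

lemma Ck_real_mult:
  "Ck_real k I f \<Longrightarrow> Ck_real k I g \<Longrightarrow> Ck_real k I (\<lambda>s. f s * g s)"
proof (induction k arbitrary: f g)
  case 0
  then show ?case by (auto intro: continuous_on_mult)
next
  case (Suc k)
  then obtain f' g' where
    "\<forall>s\<in>I. (f has_real_derivative f' s) (at s)" "Ck_real k I f'"
    "\<forall>s\<in>I. (g has_real_derivative g' s) (at s)" "Ck_real k I g'"
    by auto
  then show ?case
    \<comment> \<open>The product rule keeps one undifferentiated factor in each term, which is
      needed only at order \<open>k\<close>.\<close>
    using Ck_real_Suc_imp[OF Suc.prems(1)] Ck_real_Suc_imp[OF Suc.prems(2)]
    by (intro Ck_realI[where f' = "\<lambda>s. f' s * g s + g' s * f s"] Ck_real_add Suc.IH)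
       (auto intro: DERIV_mult)
qed

lemma Ck_real_compose:
  assumes "g ` I \<subseteq> J"
  shows "Ck_real k J f \<Longrightarrow> Ck_real k I g \<Longrightarrow> Ck_real k I (\<lambda>s. f (g s))"
proof (induction k arbitrary: f)
  case 0
  then show ?case using assms by (auto intro: continuous_on_compose2)
next
  case (Suc k)
  then obtain f' g' where
    f': "\<forall>s\<in>J. (f has_real_derivative f' s) (at s)" "Ck_real k J f'" and
    g': "\<forall>s\<in>I. (g has_real_derivative g' s) (at s)" "Ck_real k I g'"
    by auto
  have "((\<lambda>s. f (g s)) has_real_derivative f' (g s) * g' s) (at s)" if "s \<in> I" for s
    using f'(1) g'(1) assms that by (intro DERIV_chain2) auto
  then show ?case
    using Ck_real_mult[OF Suc.IH[OF f'(2) Ck_real_Suc_imp[OF Suc.prems(2)]] g'(2)]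
    by (rule Ck_realI)
qed

lemma Ck_real_powr: "Ck_real k {0<..} (\<lambda>s. s powr r)"
proof (induction k arbitrary: r)
  case 0
  show ?case by (auto intro!: continuous_intros)
next
  case (Suc k)
  show ?case
    by (rule Ck_realI[where f' = "\<lambda>s. r * s powr (r - 1)"])
       (auto intro: has_real_derivative_powr Ck_real_mult Ck_real_const Suc)
qed

section \<open>Transfer to functions of two variables\<close>

lemma Ck_on_cong:
  assumes U: "open U" and eq: "\<And>x. x \<in> U \<Longrightarrow> f x = g x" and f: "Ck_on k U f"
  shows "Ck_on k U g"
  using eq f
proof (induction k arbitrary: f g)
  case 0
  then show ?case using continuous_on_cong[OF refl 0(1)] by simp
next
  case (Suc k)
  \<comment> \<open>\<open>frechet_derivative\<close> is defined by choice, so the two functions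
    must have the same set of derivatives at each point.\<close>
  have D: "(f has_derivative D) (at x) \<longleftrightarrow> (g has_derivative D) (at x)" if "x \<in> U" for x D
    using has_derivative_transform_within_open[OF _ U that, of f D UNIV g]
      has_derivative_transform_within_open[OF _ U that, of g D UNIV f] Suc.prems(1) by auto
  have "frechet_derivative f (at x) = frechet_derivative g (at x)" if "x \<in> U" for x
    unfolding frechet_derivative_def using D[OF that] by simp
  then have "Ck_on k U (\<lambda>x. frechet_derivative g (at x) v)" for v
    using Suc.prems(2) by - (rule Suc.IH[of "\<lambda>x. frechet_derivative f (at x) v"], auto)
  moreover have "g differentiable (at x)" if "x \<in> U" for x
    using Suc.prems(2) D[OF that] that unfolding Ck_on.simps differentiable_def by blast
  ultimately show ?case by simp
qed

text \<open>The constant \<open>c\<close> makes the induction close: the derivative in direction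
  \<open>v\<close> is \<open>h'\<close> of the second coordinate times the new constant
  \<open>snd v * c\<close>, again of the same form.\<close>

lemma Ck_on_snd:
  assumes I: "open I"
  shows "Ck_real k I h \<Longrightarrow> Ck_on k (UNIV \<times> I :: (real \<times> real) set) (\<lambda>\<xi>. h (snd \<xi>) * c)"
proof (induction k arbitrary: h c)
  case 0
  then show ?case by (auto intro!: continuous_intros continuous_on_compose2[of I h])
next
  case (Suc k)
  then obtain h' where h': "\<And>s. s \<in> I \<Longrightarrow> (h has_real_derivative h' s) (at s)" and C: "Ck_real k I h'"
    by auto
  have D: "((\<lambda>\<xi>::real \<times> real. h (snd \<xi>) * c) has_derivative (\<lambda>v. h' (snd \<xi>) * (snd v * c))) (at \<xi>)"
    if "\<xi> \<in> UNIV \<times> I" for \<xi>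
  proof -
    have "(h has_derivative (*) (h' (snd \<xi>))) (at (snd \<xi>))"
      using h'[of "snd \<xi>"] that by (auto simp: has_field_derivative_def)
    from has_derivative_compose[OF has_derivative_snd[OF has_derivative_ident] this]
    have "((\<lambda>\<xi>. h (snd \<xi>)) has_derivative (\<lambda>v. h' (snd \<xi>) * snd v)) (at \<xi>)" .
    from has_derivative_mult_left[OF this, of c] show ?thesis by (simp add: mult.assoc)
  qed
  have "Ck_on k (UNIV \<times> I) (\<lambda>\<xi>::real \<times> real. frechet_derivative (\<lambda>\<xi>. h (snd \<xi>) * c) (at \<xi>) v)" for v
    by (rule Ck_on_cong[OF _ _ Suc.IH[OF C, of "snd v * c"]])
       (auto simp: open_Times I frechet_derivative_at[OF D, symmetric])
  moreover have "(\<lambda>\<xi>::real \<times> real. h (snd \<xi>) * c) differentiable (at \<xi>)" if "\<xi> \<in> UNIV \<times> I" for \<xi>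
    using D[OF that] by (auto simp: differentiable_def)
  ultimately show ?case by simp
qed

section \<open>Differentiation under the integral sign\<close>

text \<open>The difference quotients converge pointwise to \<open>k' r y\<close>, and the mean value
  inequality bounds them by \<open>b y\<close>. Dominated convergence, applied along an arbitrary
  sequence tending to \<open>r\<close>, then gives the limit.\<close>

lemma DERIV_integral:
  fixes k k' :: "real \<Rightarrow> 'a \<Rightarrow> real"
  assumes r: "\<alpha> < r" "r < \<beta>"
    and D: "\<And>t y. \<alpha> < t \<Longrightarrow> t < \<beta> \<Longrightarrow> ((\<lambda>t. k t y) has_real_derivative k' t y) (at t)"
    and bound: "\<And>t y. \<alpha> < t \<Longrightarrow> t < \<beta> \<Longrightarrow> \<bar>k' t y\<bar> \<le> b y"
    and b: "integrable M b"
    and int: "\<And>t. \<alpha> < t \<Longrightarrow> t < \<beta> \<Longrightarrow> integrable M (k t)"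
    and meas: "k' r \<in> borel_measurable M"
  shows "((\<lambda>t. LINT y|M. k t y) has_real_derivative (LINT y|M. k' r y)) (at r)"
proof -
  let ?I = "{\<alpha><..<\<beta>}"
  have rI: "r \<in> ?I" using r by simp
  have "((\<lambda>t. ((LINT y|M. k t y) - (LINT y|M. k r y)) / (t - r)) \<longlongrightarrow> (LINT y|M. k' r y)) (at r within ?I)"
    unfolding tendsto_at_iff_sequentially comp_def
  proof (intro allI impI)
    fix X :: "nat \<Rightarrow> real" assume X: "\<forall>i. X i \<in> ?I - {r}" and lim: "X \<longlonglongrightarrow> r"
    have XI: "\<alpha> < X i" "X i < \<beta>" "X i \<noteq> r" for i using X by auto
    have "(\<lambda>i. LINT y|M. (k (X i) y - k r y) / (X i - r)) \<longlonglongrightarrow> (LINT y|M. k' r y)"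
    proof (rule integral_dominated_convergence[where w = b])
      show "k' r \<in> borel_measurable M" by (rule meas)
      show "integrable M b" by (rule b)
      show "(\<lambda>y. (k (X i) y - k r y) / (X i - r)) \<in> borel_measurable M" for i
        using int[OF XI(1,2)[of i]] int[OF r] by measurable
      show "AE y in M. (\<lambda>i. (k (X i) y - k r y) / (X i - r)) \<longlonglongrightarrow> k' r y"
      proof (rule AE_I2)
        fix y
        have "((\<lambda>t. (k t y - k r y) / (t - r)) \<longlongrightarrow> k' r y) (at r within ?I)"
          using D[OF r] by (auto simp: has_field_derivative_iff at_within_open[OF rI])
        then show "(\<lambda>i. (k (X i) y - k r y) / (X i - r)) \<longlonglongrightarrow> k' r y"
          unfolding tendsto_at_iff_sequentially comp_def using X lim by blast
      qed
      show "AE y in M. norm ((k (X i) y - k r y) / (X i - r)) \<le> b y" for i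
      proof (rule AE_I2)
        fix y
        have "norm (k (X i) y - k r y) \<le> b y * norm (X i - r)"
          by (rule field_differentiable_bound[of ?I "\<lambda>t. k t y" "\<lambda>t. k' t y"])
             (use r XI[of i] D bound in \<open>auto intro: has_field_derivative_at_within\<close>)
        then show "norm ((k (X i) y - k r y) / (X i - r)) \<le> b y"
          using XI(3)[of i] by (simp add: field_simps)
      qed
    qed
    moreover have "(LINT y|M. (k (X i) y - k r y) / (X i - r))
        = ((LINT y|M. k (X i) y) - (LINT y|M. k r y)) / (X i - r)" for i

      using int[OF XI(1,2)[of i]] int[OF r] by simp
    ultimately show "(\<lambda>i. ((LINT y|M. k (X i) y) - (LINT y|M. k r y)) / (X i - r))
        \<longlonglongrightarrow> (LINT y|M. k' r y)" by (simp only:)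
  qed
  then show ?thesis by (simp add: has_field_derivative_iff at_within_open[OF rI])
qed

text \<open>Of the \<open>Suc n\<close> factors in the denominator, \<open>n\<close> are bounded
  below by \<open>r\<close> and the last one is comparable to \<open>1 + y\<^sup>2\<close>.\<close>

lemma integrable_stieltjes:
  fixes w :: "real \<Rightarrow> real"
  assumes w: "integrable lborel (\<lambda>y. w y / (1 + y\<^sup>2))" and r: "r > 0"
  shows "integrable lborel (\<lambda>y. w y / (r + y\<^sup>2) ^ Suc n)"
proof -
  let ?K = "max 1 (1 / r)"
  have pos: "1 + y\<^sup>2 > 0" "r + y\<^sup>2 > 0" for y :: real using r by (auto intro: add_pos_nonneg)
  \<comment> \<open>Measurability of \<open>w\<close> is recovered from that of the
    quotient.\<close>
  have "(\<lambda>y. w y / (1 + y\<^sup>2) * (1 + y\<^sup>2)) \<in> borel_measurable lborel"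
    using w by measurable
  moreover have "w y / (1 + y\<^sup>2) * (1 + y\<^sup>2) = w y" for y using pos(1)[of y] by simp
  ultimately have [measurable]: "w \<in> borel_measurable borel" by simp
  have "integrable lborel (\<lambda>y. (1 / r) ^ n * ?K * (w y / (1 + y\<^sup>2)))"
    using w by (rule integrable_mult_right)
  then show ?thesis
  proof (rule Bochner_Integration.integrable_bound)
    show "(\<lambda>y. w y / (r + y\<^sup>2) ^ Suc n) \<in> borel_measurable lborel" by measurable
    have "\<bar>w y / (r + y\<^sup>2) ^ Suc n\<bar> \<le> \<bar>(1 / r) ^ n * ?K * (w y / (1 + y\<^sup>2))\<bar>" for y
    proof -
      have "1 / (r + y\<^sup>2) ^ n \<le> (1 / r) ^ n"
        using r pos[of y] by (auto simp: power_one_over intro!: divide_left_mono power_mono mult_pos_pos)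
      moreover have "1 / (r + y\<^sup>2) \<le> ?K / (1 + y\<^sup>2)"
      proof -
        have "?K * r \<ge> 1" using r by (auto simp: max_def field_simps)
        moreover have "?K * y\<^sup>2 \<ge> 1 * y\<^sup>2" by (intro mult_right_mono) auto
        ultimately have "1 + y\<^sup>2 \<le> ?K * (r + y\<^sup>2)" by (simp add: distrib_left)
        then show ?thesis using pos[of y] by (simp add: field_simps)
      qed
      ultimately have "1 / (r + y\<^sup>2) ^ n * (1 / (r + y\<^sup>2)) \<le> (1 / r) ^ n * (?K / (1 + y\<^sup>2))"
        using r pos[of y] by (intro mult_mono) auto
      then have "\<bar>w y\<bar> * (1 / (r + y\<^sup>2) ^ n * (1 / (r + y\<^sup>2))) \<le> \<bar>w y\<bar> * ((1 / r) ^ n * (?K / (1 + y\<^sup>2)))"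
        by (intro mult_left_mono) auto
      then show ?thesis using r pos[of y] by (simp add: abs_mult mult_ac power_one_over)
    qed
    then show "AE y in lborel. norm (w y / (r + y\<^sup>2) ^ Suc n) \<le> norm ((1 / r) ^ n * ?K * (w y / (1 + y\<^sup>2)))"
      by (intro AE_I2) simp
  qed
qed

lemma DERIV_stieltjes:
  fixes w :: "real \<Rightarrow> real"
  assumes w: "integrable lborel (\<lambda>y. w y / (1 + y\<^sup>2))" and r: "r > 0"
  shows "((\<lambda>r. LINT y|lborel. w y / (r + y\<^sup>2) ^ Suc n) has_real_derivative
           - real (Suc n) * (LINT y|lborel. w y / (r + y\<^sup>2) ^ Suc (Suc n))) (at r)"
proof -
  have pos: "t + y\<^sup>2 > 0" if "t > 0" for t y :: real using that by (auto intro: add_pos_nonneg)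
  have e: "v * - (inverse (z ^ Suc n) * (real (Suc n) * z ^ n) * inverse (z ^ Suc n))
      = - real (Suc n) * (v / z ^ Suc (Suc n))" if "z > 0" for v z :: real
    using that by (simp add: field_simps)
  have "((\<lambda>r. LINT y|lborel. w y / (r + y\<^sup>2) ^ Suc n) has_real_derivative
           (LINT y|lborel. - real (Suc n) * (w y / (r + y\<^sup>2) ^ Suc (Suc n)))) (at r)"
  \<comment> \<open>On this interval every denominator exceeds its value at \<open>r / 2\<close>, so
    the derivative at \<open>r / 2\<close> yields a dominating function.\<close>
  proof (rule DERIV_integral[where \<alpha> = "r / 2" and \<beta> = "2 * r"
        and b = "\<lambda>y. real (Suc n) * \<bar>w y / (r / 2 + y\<^sup>2) ^ Suc (Suc n)\<bar>"])
    fix t y :: real assume t: "r / 2 < t" "t < 2 * r"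
    have tp: "t > 0" "r / 2 > 0" using t r by auto
    have "((\<lambda>t. w y * inverse ((t + y\<^sup>2) ^ Suc n)) has_real_derivative
        w y * - (inverse ((t + y\<^sup>2) ^ Suc n) * (real (Suc n) * (t + y\<^sup>2) ^ n) *
          inverse ((t + y\<^sup>2) ^ Suc n))) (at t)"
      using pos[OF tp(1), of y]
      by (intro DERIV_cmult DERIV_inverse')
         (use DERIV_power_Suc[of "\<lambda>t. t + y\<^sup>2" 1 t UNIV n] in
           \<open>auto intro!: derivative_eq_intros simp del: power_Suc\<close>)
    also have "w y * - (inverse ((t + y\<^sup>2) ^ Suc n) * (real (Suc n) * (t + y\<^sup>2) ^ n) *
          inverse ((t + y\<^sup>2) ^ Suc n)) = - real (Suc n) * (w y / (t + y\<^sup>2) ^ Suc (Suc n))"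
      using e[OF pos[OF tp(1), of y]] by simp
    finally show "((\<lambda>t. w y / (t + y\<^sup>2) ^ Suc n) has_real_derivative
        - real (Suc n) * (w y / (t + y\<^sup>2) ^ Suc (Suc n))) (at t)"
      by (simp add: divide_inverse)
    have "\<bar>w y\<bar> / (t + y\<^sup>2) ^ Suc (Suc n) \<le> \<bar>w y\<bar> / (r / 2 + y\<^sup>2) ^ Suc (Suc n)"
      using t pos[OF tp(1), of y] pos[OF tp(2), of y]
      by (intro divide_left_mono power_mono mult_pos_pos zero_less_power) auto
    then show "\<bar>- real (Suc n) * (w y / (t + y\<^sup>2) ^ Suc (Suc n))\<bar>
        \<le> real (Suc n) * \<bar>w y / (r / 2 + y\<^sup>2) ^ Suc (Suc n)\<bar>"
      using pos[OF tp(1), of y] pos[OF tp(2), of y] mult_left_mono[of _ _ "real (Suc n)"]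
      by (simp add: abs_mult abs_divide power_abs abs_of_pos del: power_Suc of_nat_Suc
          flip: times_divide_eq_right)
  next
    show "integrable lborel (\<lambda>y. real (Suc n) * \<bar>w y / (r / 2 + y\<^sup>2) ^ Suc (Suc n)\<bar>)"
      using r integrable_stieltjes[OF w, of "r / 2" "Suc n"] by (intro integrable_mult_right integrable_abs) auto
    show "integrable lborel (\<lambda>y. w y / (t + y\<^sup>2) ^ Suc n)" if "r / 2 < t" for t
      using r that integrable_stieltjes[OF w, of t n] by auto
    show "(\<lambda>y. - real (Suc n) * (w y / (r + y\<^sup>2) ^ Suc (Suc n))) \<in> borel_measurable lborel"
      using borel_measurable_integrable[OF integrable_stieltjes[OF w r, of "Suc n"]]
      by (intro borel_measurable_times) auto
  qed (use r in auto)
  then show ?thesis by (simp only: integral_mult_right_zero)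
qed

text \<open>Differentiation reproduces the same family with \<open>n\<close> raised by one, so the
  induction on \<open>k\<close> runs for all \<open>n\<close> at once.\<close>

lemma Ck_real_stieltjes:
  fixes w :: "real \<Rightarrow> real"
  assumes w: "integrable lborel (\<lambda>y. w y / (1 + y\<^sup>2))"
  shows "Ck_real k {0<..} (\<lambda>r. LINT y|lborel. w y / (r + y\<^sup>2) ^ Suc n)"
proof (induction k arbitrary: n)
  case 0
  show ?case unfolding Ck_real.simps
    using DERIV_isCont[OF DERIV_stieltjes[OF w]] by (auto intro!: continuous_at_imp_continuous_on)
next
  case (Suc k)
  show ?case
    by (rule Ck_realI[OF DERIV_stieltjes[OF w]])
       (auto intro!: Ck_real_mult Ck_real_const Suc simp del: power_Suc)
qed

section \<open>The metric coefficients\<close>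

primrec score :: "real \<Rightarrow> coord \<Rightarrow> real \<Rightarrow> real" where
  "score q Mu y = - 2 * y / (3 - q)"
| "score q Sg y = 1 - y\<^sup>2"

text \<open>This serves the uniqueness of the metric: a bilinear form is determined by its values on
  the coordinate fields.\<close>

lemma bilinear_expand_coord:
  fixes B :: "real \<times> real \<Rightarrow> real \<times> real \<Rightarrow> real"
  assumes "bilinear B"
  shows "B v w = fst v * fst w * B (1, 0) (1, 0) + fst v * snd w * B (1, 0) (0, 1)
    + snd v * fst w * B (0, 1) (1, 0) + snd v * snd w * B (0, 1) (0, 1)"
proof -
  have v: "v = fst v *\<^sub>R (1, 0) + snd v *\<^sub>R (0, 1)" for v :: "real \<times> real"
    by (simp add: prod_eq_iff)
  have "B v w = B (fst v *\<^sub>R (1, 0) + snd v *\<^sub>R (0, 1)) (fst w *\<^sub>R (1, 0) + snd w *\<^sub>R (0, 1))"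
    using v[of v] v[of w] by simp
  also have "\<dots> = fst v * fst w * B (1, 0) (1, 0) + fst v * snd w * B (1, 0) (0, 1)
    + snd v * fst w * B (0, 1) (1, 0) + snd v * snd w * B (0, 1) (0, 1)"
    unfolding bilinear_ladd[OF assms] bilinear_radd[OF assms]
      bilinear_lmul[OF assms] bilinear_rmul[OF assms]
    by (simp add: algebra_simps)
  finally show ?thesis .
qed

locale q_gaussian_family =
  fixes q a :: real
  assumes q: "1 \<le> q" "q < 3" and a: "a \<noteq> 0"
    and qa: "q = 1 \<or> (q > 1 \<and> 1 - a < q / (q - 1))"
begin

section \<open>The standard profile and the normalising constant\<close>

definition std_gauss :: "real \<Rightarrow> real" where
  "std_gauss y = exp_q q (- (1 / (3 - q) * y\<^sup>2))"

abbreviation Z :: real where "Z \<equiv> Z_q q"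

lemma std_gauss_domain: "1 + (1 - q) * - (1 / (3 - q) * y\<^sup>2) > 0"
  using q by (intro exp_q_domain_nonpos) auto

lemma std_gauss_pos: "std_gauss y > 0"
  unfolding std_gauss_def by (rule exp_q_pos[OF std_gauss_domain])

lemma std_gauss_le_1: "std_gauss y \<le> 1"
  unfolding std_gauss_def using q by (intro exp_q_le_1) auto

lemma std_gauss_eq_1: "std_gauss y = 1 \<Longrightarrow> y = 0"
  using exp_q_less_1[OF q(1), of "- (1 / (3 - q) * y\<^sup>2)"] q
  by (cases "y = 0") (auto simp: std_gauss_def)

lemma std_gauss_0 [simp]: "std_gauss 0 = 1"
  by (simp add: std_gauss_def)

lemma ln_q_std_gauss: "ln_q q (std_gauss y) = - (y\<^sup>2 / (3 - q))"
  unfolding std_gauss_def using ln_q_exp_q[OF std_gauss_domain] by simp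

lemma measurable_std_gauss [measurable]: "std_gauss \<in> borel_measurable borel"
  using borel_measurable_continuous_onI[OF continuous_on_exp_q_quadratic[of q "1 / (3 - q)"]] q
  by (simp add: std_gauss_def[abs_def])

lemma Z_pos: "Z > 0"
proof -
  have "integrable lborel (\<lambda>x. exp_q q (- (1 * x\<^sup>2)))"
    by (rule integrable_exp_q_quadratic[OF q]) simp
  moreover have p: "exp_q q (- (x\<^sup>2)) > 0" for x
    using q by (intro exp_q_pos exp_q_domain_nonpos) auto
  ultimately have "0 < (LINT x|lborel. exp_q q (- (x\<^sup>2)))"
    by (intro integral_pos_finite_zeros) (auto simp: less_imp_le less_imp_neq[symmetric])
  then show ?thesis using q by (simp add: Z_q_def)
qed

lemma q_gaussian_eq: "q_gaussian q (\<mu>, \<sigma>) x = 1 / (Z * \<sigma>) * std_gauss ((x - \<mu>) / \<sigma>)"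
  by (simp add: q_gaussian_def std_gauss_def)

section \<open>The threshold \<open>T_qa\<close> and the admissible values of
  \<open>\<sigma>\<close>\<close>

lemma T_qa_arg: "1 + (1 - q) * max 0 ((1 - a) / q) > 0"
proof (cases "q = 1 \<or> 1 - a \<le> 0")
  case True
  then show ?thesis using q by (auto simp: max_def divide_le_0_iff field_simps)
next
  case False
  then have "q > 1" "1 - a < q / (q - 1)" "1 - a > 0" using q qa by auto
  \<comment> \<open>The condition linking \<open>q\<close> and \<open>a\<close> says exactly that
    \<open>(1 - a) / q\<close> lies in the domain of \<open>exp_q\<close>.\<close>
  then have "(q - 1) * (1 - a) / q < 1" by (simp add: field_simps)
  moreover have "max 0 ((1 - a) / q) = (1 - a) / q"
    using False q by (simp add: max_def)
  moreover have "(1 - q) * ((1 - a) / q) = - ((q - 1) * (1 - a) / q)"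
    using q by (simp add: field_simps)
  ultimately show ?thesis by linarith
qed

lemma T_qa_pos: "T_qa q a > 0"
  unfolding T_qa_def using exp_q_pos[OF T_qa_arg] by simp

lemma ln_q_inverse:
  assumes "t > 0"
  shows "ln_q q (1 / t) = t powr (q - 1) * - ln_q q t"
proof -
  have "0 = ln_q q t + t powr (1 - q) * ln_q q (1 / t)"
    using ln_q_mult[of t "1 / t" q] assms by simp
  then have "- ln_q q t = t powr (1 - q) * ln_q q (1 / t)" by linarith
  then have "t powr (q - 1) * - ln_q q t = t powr (q - 1) * t powr (1 - q) * ln_q q (1 / t)"
    by (simp add: mult.assoc)
  also have "t powr (q - 1) * t powr (1 - q) = 1" using assms by (simp flip: powr_add)
  finally show ?thesis by simp
qed

text \<open>Applying \<open>ln_q\<close> to \<open>1 / t > 1 / T_qa q a\<close> gives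
  \<open>ln_q q (1 / t) > max 0 ((1 - a) / q)\<close>. The entry 0 of the maximum yields the first
  claim, the other entry the second, which is the sign condition for the second derivative of
  \<open>exp_qa\<close>.\<close>

lemma below_T_qa:
  assumes t: "0 < t" "t < T_qa q a"
  shows "t < 1" and "1 - a < q * (t powr (q - 1) * - ln_q q t)"
proof -
  let ?c = "max 0 ((1 - a) / q)"
  have "exp_q q ?c < 1 / t"
    using t exp_q_pos[OF T_qa_arg] by (simp add: T_qa_def field_simps)
  from ln_q_less[OF exp_q_pos[OF T_qa_arg] this, of q]
  have *: "?c < ln_q q (1 / t)" unfolding ln_q_exp_q[OF T_qa_arg] .
  have "(1 - a) / q < ln_q q (1 / t)" using * by simp
  then show "1 - a < q * (t powr (q - 1) * - ln_q q t)"
    using q by (simp add: ln_q_inverse[OF t(1)] field_simps)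
  have "t powr (q - 1) * - ln_q q t > 0" using * by (simp add: ln_q_inverse[OF t(1)])
  then have "ln_q q t < 0" using t by (simp add: zero_less_mult_iff mult_less_0_iff)
  then show "t < 1" using t ln_q_neg_iff by simp
qed

lemma Sigma_qaD:
  assumes "\<sigma> \<in> Sigma_qa q a"
  shows "\<sigma> > 0" "1 / (Z * \<sigma>) < T_qa q a" "Z * \<sigma> > 0"
  using assms Z_pos by (auto simp: Sigma_qa_def)

lemma open_Sigma_qa: "open (Sigma_qa q a)"
proof -
  have "1 / (Z * \<sigma>) < T_qa q a \<longleftrightarrow> 1 / (Z * T_qa q a) < \<sigma>" if "\<sigma> > 0" for \<sigma>
  proof -
    have "1 / (Z * \<sigma>) < T_qa q a \<longleftrightarrow> 1 < T_qa q a * (Z * \<sigma>)"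
      by (rule pos_divide_less_eq) (rule mult_pos_pos[OF Z_pos that])
    moreover have "1 / (Z * T_qa q a) < \<sigma> \<longleftrightarrow> 1 < \<sigma> * (Z * T_qa q a)"
      by (rule pos_divide_less_eq) (rule mult_pos_pos[OF Z_pos T_qa_pos])
    ultimately show ?thesis by (simp only: mult_ac)
  qed
  then have "Sigma_qa q a = {0<..} \<inter> {1 / (Z * T_qa q a)<..}"
    unfolding Sigma_qa_def by blast
  then show ?thesis by (simp only: open_Int open_greaterThan)
qed

lemma q_gaussian_bounds:
  assumes "\<sigma> \<in> Sigma_qa q a"
  shows "0 < q_gaussian q (\<mu>, \<sigma>) x" "q_gaussian q (\<mu>, \<sigma>) x < T_qa q a"
    "q_gaussian q (\<mu>, \<sigma>) x < 1" "ln_q q (q_gaussian q (\<mu>, \<sigma>) x) < 0"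
proof -
  note S = Sigma_qaD[OF assms]
  let ?y = "(x - \<mu>) / \<sigma>"
  show pos: "0 < q_gaussian q (\<mu>, \<sigma>) x"
    using S std_gauss_pos[of ?y] by (simp add: q_gaussian_eq)
  have "1 / (Z * \<sigma>) * std_gauss ?y \<le> 1 / (Z * \<sigma>) * 1"
    using S std_gauss_le_1 by (intro mult_left_mono) auto
  then show T: "q_gaussian q (\<mu>, \<sigma>) x < T_qa q a"
    using S by (simp add: q_gaussian_eq)
  show "q_gaussian q (\<mu>, \<sigma>) x < 1" by (rule below_T_qa(1)[OF pos T])
  then show "ln_q q (q_gaussian q (\<mu>, \<sigma>) x) < 0" using pos by (simp add: ln_q_neg)
qed

section \<open>The logarithm of the density and its partial derivatives\<close>

definition shape :: "real \<Rightarrow> real" where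
  "shape \<sigma> = (3 - q) * ln_q q (Z * \<sigma>)"

text \<open>The peak value \<open>1 / (Z * \<sigma>)\<close> lies below \<open>T_qa\<close>, hence
  below 1, so \<open>Z * \<sigma> > 1\<close>. This places the parameter of the Stieltjes transform
  in the region where it is smooth.\<close>

lemma shape_pos:
  assumes "\<sigma> \<in> Sigma_qa q a"
  shows "shape \<sigma> > 0"
proof -
  have "1 / (Z * \<sigma>) < 1"
    using below_T_qa(1)[OF _ Sigma_qaD(2)[OF assms]] Sigma_qaD[OF assms] by simp
  then have "ln_q q (Z * \<sigma>) > 0"
    using Sigma_qaD[OF assms] ln_q_less[of 1 "Z * \<sigma>" q] by simp
  then show ?thesis using q by (simp add: shape_def)
qed

text \<open>Both forms come from \<open>ln_q_mult\<close>. The first separates the dependence on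
  \<open>\<mu>\<close> from that on \<open>\<sigma>\<close> and is the one to differentiate; the
  second is factored as needed for the weight.\<close>

lemma neg_ln_q_q_gaussian:
  assumes "\<sigma> > 0"
  shows "- ln_q q (q_gaussian q (\<mu>, \<sigma>) x)
      = - ln_q q (1 / (Z * \<sigma>)) + Z powr (q - 1) * \<sigma> powr (q - 3) / (3 - q) * (x - \<mu>)\<^sup>2"
    and "- ln_q q (q_gaussian q (\<mu>, \<sigma>) x)
      = (Z * \<sigma>) powr (q - 1) / (3 - q) * (shape \<sigma> + ((x - \<mu>) / \<sigma>)\<^sup>2)"
proof -
  let ?K = "Z * \<sigma>" and ?y = "(x - \<mu>) / \<sigma>"
  have K: "?K > 0" using assms Z_pos by simp
  have inv: "(1 / ?K) powr (1 - q) = ?K powr (q - 1)"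
    using K powr_minus_divide[of ?K "1 - q"] by (simp add: powr_divide)
  have L: "- ln_q q (q_gaussian q (\<mu>, \<sigma>) x)
      = - ln_q q (1 / ?K) + ?K powr (q - 1) * (?y\<^sup>2 / (3 - q))"
    unfolding q_gaussian_eq using ln_q_mult[of "1 / ?K" "std_gauss ?y" q] K std_gauss_pos
    by (simp add: ln_q_std_gauss inv)
  have "?K powr (q - 1) * (?y\<^sup>2 / (3 - q)) = Z powr (q - 1) * (\<sigma> powr (q - 1) / \<sigma>\<^sup>2) / (3 - q) * (x - \<mu>)\<^sup>2"
    using assms Z_pos by (simp add: powr_mult power_divide)
  also have "\<sigma> powr (q - 1) / \<sigma>\<^sup>2 = \<sigma> powr (q - 3)"
    using assms powr_diff[of \<sigma> "q - 1" 2] by simp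
  finally show "- ln_q q (q_gaussian q (\<mu>, \<sigma>) x)
      = - ln_q q (1 / ?K) + Z powr (q - 1) * \<sigma> powr (q - 3) / (3 - q) * (x - \<mu>)\<^sup>2"
    using L by simp
  have "- ln_q q (1 / ?K) = ?K powr (q - 1) * ln_q q ?K"
    by (simp add: ln_q_inverse[OF K])
  then have "- ln_q q (q_gaussian q (\<mu>, \<sigma>) x) = ?K powr (q - 1) * (ln_q q ?K + ?y\<^sup>2 / (3 - q))"
    using L by (simp add: distrib_left)
  also have "ln_q q ?K + ?y\<^sup>2 / (3 - q) = (shape \<sigma> + ?y\<^sup>2) / (3 - q)"
    using q by (simp add: shape_def add_divide_distrib)
  finally show "- ln_q q (q_gaussian q (\<mu>, \<sigma>) x)
      = ?K powr (q - 1) / (3 - q) * (shape \<sigma> + ?y\<^sup>2)" by simp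
qed

definition scale :: "real \<Rightarrow> real" where
  "scale \<sigma> = Z powr (q - 1) * \<sigma> powr (q - 2)"

lemma DERIV_neg_ln_q_q_gaussian:
  assumes "\<sigma> > 0"
  shows "((\<lambda>m. - ln_q q (q_gaussian q (m, \<sigma>) x)) has_real_derivative
           scale \<sigma> * score q Mu ((x - \<mu>) / \<sigma>)) (at \<mu>)" (is ?Mu)
    and "((\<lambda>s. - ln_q q (q_gaussian q (\<mu>, s) x)) has_real_derivative
           scale \<sigma> * score q Sg ((x - \<mu>) / \<sigma>)) (at \<sigma>)" (is ?Sg)
proof -
  let ?B = "\<lambda>\<sigma>. Z powr (q - 1) * \<sigma> powr (q - 3) / (3 - q)"
  have p3: "\<sigma> powr (q - 3) = \<sigma> powr (q - 2) / \<sigma>"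
    using assms powr_diff[of \<sigma> "q - 2" 1] by simp
  have p4: "\<sigma> powr (q - 3 - 1) = \<sigma> powr (q - 2) / \<sigma>\<^sup>2"
    using assms powr_diff[of \<sigma> "q - 2" 2] by simp
  have "((\<lambda>m. - ln_q q (1 / (Z * \<sigma>)) + ?B \<sigma> * (x - m)\<^sup>2) has_real_derivative
      ?B \<sigma> * (2 * (x - \<mu>) * - 1)) (at \<mu>)"
    using q by (auto intro!: derivative_eq_intros)
  also have "?B \<sigma> * (2 * (x - \<mu>) * - 1) = scale \<sigma> * score q Mu ((x - \<mu>) / \<sigma>)"
    using q by (simp add: scale_def p3)
  finally show ?Mu by (simp add: neg_ln_q_q_gaussian(1)[OF assms])
  have K: "Z * \<sigma> > 0" using assms Z_pos by simp
  have "((\<lambda>s. 1 / (Z * s)) has_real_derivative - (1 / (Z * \<sigma>\<^sup>2))) (at \<sigma>)"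
    using assms Z_pos by (auto intro!: derivative_eq_intros simp: field_simps power2_eq_square)
  then have "((\<lambda>s. - ln_q q (1 / (Z * s))) has_real_derivative
      - ((1 / (Z * \<sigma>)) powr - q * - (1 / (Z * \<sigma>\<^sup>2)))) (at \<sigma>)"
    using K by (intro DERIV_minus DERIV_chain2[OF DERIV_ln_q]) auto
  moreover have "- ((1 / (Z * \<sigma>)) powr - q * - (1 / (Z * \<sigma>\<^sup>2))) = scale \<sigma>"
  proof -
    have "(1 / (Z * \<sigma>)) powr - q = Z powr q * \<sigma> powr q"
      using K assms Z_pos by (simp add: powr_divide powr_minus powr_mult)
    moreover have "\<sigma> powr (q - 2) = \<sigma> powr q / \<sigma>\<^sup>2"
      using assms powr_diff[of \<sigma> q 2] by simp
    moreover have "Z powr (q - 1) = Z powr q / Z"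
      using Z_pos powr_diff[of Z q 1] by simp
    ultimately show ?thesis by (simp add: scale_def)
  qed
  ultimately have A: "((\<lambda>s. - ln_q q (1 / (Z * s))) has_real_derivative scale \<sigma>) (at \<sigma>)"
    by simp
  \<comment> \<open>The factor \<open>q - 3\<close> from the exponent cancels the denominator up to
    sign. Both terms thus carry the same factor \<open>scale \<sigma>\<close>, and
    \<open>1 - y\<^sup>2\<close> is what remains.\<close>
  have "(?B has_real_derivative Z powr (q - 1) * ((q - 3) * \<sigma> powr (q - 3 - 1)) / (3 - q)) (at \<sigma>)"
    using assms by (intro DERIV_cdivide DERIV_cmult has_real_derivative_powr)
  also have "Z powr (q - 1) * ((q - 3) * \<sigma> powr (q - 3 - 1)) / (3 - q) = - scale \<sigma> / \<sigma>\<^sup>2"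
  proof -
    have "(q - 3) / (3 - q) = -1" using q by (simp add: divide_eq_eq)
    then have "X * ((q - 3) * Y) / (3 - q) = - (X * Y)" for X Y
      by (metis (no_types, lifting) mult.left_commute mult_minus1 times_divide_eq_left)
    then have "Z powr (q - 1) * ((q - 3) * (\<sigma> powr (q - 2) / \<sigma>\<^sup>2)) / (3 - q)
        = - (Z powr (q - 1) * (\<sigma> powr (q - 2) / \<sigma>\<^sup>2))" by blast
    then show ?thesis unfolding p4 scale_def by (simp only: times_divide_eq_right minus_divide_left)
  qed
  finally have "((\<lambda>s. - ln_q q (1 / (Z * s)) + ?B s * (x - \<mu>)\<^sup>2) has_real_derivative
      scale \<sigma> + - scale \<sigma> / \<sigma>\<^sup>2 * (x - \<mu>)\<^sup>2) (at \<sigma>)"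
    by (intro DERIV_add A DERIV_cmult_right)
  also have "scale \<sigma> + - scale \<sigma> / \<sigma>\<^sup>2 * (x - \<mu>)\<^sup>2 = scale \<sigma> * score q Sg ((x - \<mu>) / \<sigma>)"
    by (simp add: power_divide algebra_simps)
  finally show ?Sg
    by (rule has_field_derivative_transform_within_open[OF _ open_greaterThan[of 0]])
       (use assms in \<open>auto simp: neg_ln_q_q_gaussian(1)\<close>)
qed

lemma DERIV_ln_qa_q_gaussian:
  fixes \<mu> \<sigma> x :: real
  assumes "\<sigma> \<in> Sigma_qa q a"
  defines "L \<equiv> - ln_q q (q_gaussian q (\<mu>, \<sigma>) x)"
  shows "(slice s (\<lambda>\<eta>. ln_qa q a (q_gaussian q \<eta> x)) (\<mu>, \<sigma>) has_real_derivative
           - (L powr (a - 1) * (scale \<sigma> * score q s ((x - \<mu>) / \<sigma>)))) (at (coord_value s (\<mu>, \<sigma>)))"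
proof -
  have chain: "((\<lambda>t. - (1 / a) * h t powr a) has_real_derivative - (h t powr (a - 1) * h')) (at t)"
    if "(h has_real_derivative h') (at t)" "h t > 0" for h :: "real \<Rightarrow> real" and h' t
    using DERIV_cmult[OF DERIV_fun_powr[OF that, of a], of "- (1 / a)"] a by simp
  have L: "L > 0" using q_gaussian_bounds(4)[OF assms(1)] by (simp add: L_def)
  show ?thesis
    using chain[OF DERIV_neg_ln_q_q_gaussian(1)[OF Sigma_qaD(1)[OF assms(1)]], of \<mu> x] L
      chain[OF DERIV_neg_ln_q_q_gaussian(2)[OF Sigma_qaD(1)[OF assms(1)]], of \<mu> x]
    by (cases s) (auto simp: ln_qa_def L_def)
qed

section \<open>The weight against which the scores are integrated\<close>

definition weight :: "real \<Rightarrow> real \<Rightarrow> real" where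
  "weight \<sigma> y = q * std_gauss y powr (2 * q - 1)
     - (1 - a) * (3 - q) * (std_gauss y powr q / (shape \<sigma> + y\<^sup>2))"

text \<open>Each power of \<open>p\<close> splits into a power of \<open>Z * \<sigma>\<close> and
  one of the standard profile, and both terms turn out to carry the same power
  \<open>1 - 2 * q\<close> of \<open>Z * \<sigma>\<close>.\<close>

lemma metric_weight:
  assumes "\<sigma> \<in> Sigma_qa q a"
  defines "p \<equiv> \<lambda>y. 1 / (Z * \<sigma>) * std_gauss y"
    and "L \<equiv> \<lambda>y. (Z * \<sigma>) powr (q - 1) / (3 - q) * (shape \<sigma> + y\<^sup>2)"
  shows "p y powr q / L y * (q * p y powr (q - 1) * L y - (1 - a))
      = (Z * \<sigma>) powr (1 - 2 * q) * weight \<sigma> y"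
proof -
  let ?K = "Z * \<sigma>" and ?e = "std_gauss y" and ?r = "shape \<sigma> + y\<^sup>2"
  have K: "?K > 0" using Sigma_qaD[OF assms(1)] by simp
  have r: "?r > 0" using shape_pos[OF assms(1)] by (simp add: add_pos_nonneg)
  have e: "?e > 0" by (rule std_gauss_pos)
  have L: "L y > 0"
    unfolding L_def using K r q by (intro mult_pos_pos divide_pos_pos) auto
  have p: "p y powr s = ?K powr - s * ?e powr s" for s
    using K e by (simp add: p_def powr_mult powr_divide powr_minus field_simps)
  have "p y powr q / L y * (q * p y powr (q - 1) * L y - (1 - a))
      = q * (p y powr q * p y powr (q - 1)) - (1 - a) * (p y powr q / L y)"
    using L by (simp add: field_simps)
  moreover have "p y powr q * p y powr (q - 1) = ?K powr (1 - 2 * q) * ?e powr (2 * q - 1)"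
  proof -
    have "?K powr (1 - 2 * q) = ?K powr - q * ?K powr - (q - 1)"
      "?e powr (2 * q - 1) = ?e powr q * ?e powr (q - 1)"
      by (simp_all flip: powr_add)
    then show ?thesis unfolding p by (simp only: mult_ac)
  qed
  moreover have "p y powr q / L y = ?K powr (1 - 2 * q) * ((3 - q) * (?e powr q / ?r))"
  proof -
    have "?K powr - q = ?K powr (1 - 2 * q) * ?K powr (q - 1)" by (simp flip: powr_add)
    then show ?thesis using K r q by (simp add: p L_def)
  qed
  ultimately have "p y powr q / L y * (q * p y powr (q - 1) * L y - (1 - a))
      = q * (?K powr (1 - 2 * q) * ?e powr (2 * q - 1))
        - (1 - a) * (?K powr (1 - 2 * q) * ((3 - q) * (?e powr q / ?r)))"
    by (simp only:)
  also have "\<dots> = ?K powr (1 - 2 * q) * weight \<sigma> y"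
    unfolding weight_def right_diff_distrib[of "?K powr (1 - 2 * q)"] by (simp only: mult_ac)
  finally show ?thesis .
qed

lemma weight_pos:
  assumes "\<sigma> \<in> Sigma_qa q a"
  shows "weight \<sigma> y > 0"
proof -
  let ?K = "Z * \<sigma>"
  define p where "p = 1 / ?K * std_gauss y"
  define L where "L = ?K powr (q - 1) / (3 - q) * (shape \<sigma> + y\<^sup>2)"
  \<comment> \<open>Every \<open>y\<close> is realised as the standardised coordinate of a point of
    a centred density, so the bounds below the threshold apply.\<close>
  have pq: "p = q_gaussian q (0, \<sigma>) (y * \<sigma>)"
    using Sigma_qaD[OF assms] by (simp add: p_def q_gaussian_eq)
  have L: "L = - ln_q q p"
    using neg_ln_q_q_gaussian(2)[of \<sigma> 0 "y * \<sigma>"] Sigma_qaD[OF assms] by (simp add: pq L_def)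
  have b: "0 < p" "p < T_qa q a" "L > 0"
    using q_gaussian_bounds[OF assms, of 0 "y * \<sigma>"] by (auto simp: pq L)
  have "0 < p powr q / L * (q * p powr (q - 1) * L - (1 - a))"
    using b below_T_qa(2)[OF b(1,2)]
    by (intro mult_pos_pos divide_pos_pos) (auto simp: L mult.assoc)
  then have "0 < ?K powr (1 - 2 * q) * weight \<sigma> y"
    using metric_weight[OF assms, of y] by (simp add: p_def L_def)
  then show ?thesis by (simp add: zero_less_mult_iff)
qed

lemma g_integrand_eq:
  assumes "\<sigma> \<in> Sigma_qa q a"
  shows "g_integrand q a s t (\<mu>, \<sigma>) x
    = 1 / (Z * \<sigma> ^ 3) * (score q s ((x - \<mu>) / \<sigma>) * score q t ((x - \<mu>) / \<sigma>) * weight \<sigma> ((x - \<mu>) / \<sigma>))"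
proof -
  note S = Sigma_qaD[OF assms]
  let ?y = "(x - \<mu>) / \<sigma>"
  define p where "p = q_gaussian q (\<mu>, \<sigma>) x"
  define L where "L = - ln_q q p"
  have p: "0 < p" "p < 1" and L: "L > 0"
    using q_gaussian_bounds[OF assms] by (auto simp: p_def L_def)
  have pd: "partial_deriv s (\<lambda>\<eta>. ln_qa q a (q_gaussian q \<eta> x)) (\<mu>, \<sigma>)
      = - (L powr (a - 1) * (scale \<sigma> * score q s ?y))" for s
    unfolding partial_deriv_def L_def p_def
    by (rule DERIV_imp_deriv[OF DERIV_ln_qa_q_gaussian[OF assms]])
  have arg: "(- (a * ln_qa q a p)) powr (1 / a) = L"
    using ln_qa_arg[OF a p] by (simp add: L_def)
  have eL: "exp_q q (- L) = p" using exp_q_ln_q[OF p(1)] by (simp add: L_def)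
  have dd: "(deriv ^^ 2) (exp_qa q a) (ln_qa q a p)
      = p powr q * L powr (1 - 2 * a) * (q * p powr (q - 1) * L - (1 - a))"
    using DERIV_imp_deriv[OF DERIV_exp_qa(2)[OF q(1) a ln_qa_range[OF a p, of q]]]
    by (simp add: arg eL numeral_2_eq_2)
  \<comment> \<open>The powers of \<open>L\<close> from the two partial derivatives and from the
    second derivative of \<open>exp_qa\<close> combine to \<open>1 / L\<close>, so \<open>a\<close>
    survives only in the constant \<open>1 - a\<close>.\<close>
  have pow: "L powr (a - 1) * L powr (a - 1) * L powr (1 - 2 * a) = 1 / L"
  proof -
    have "L powr (a - 1) * L powr (a - 1) * L powr (1 - 2 * a) = L powr (- 1)"
      by (simp flip: powr_add)
    then show ?thesis using L by (simp add: powr_minus_divide)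
  qed
  have "g_integrand q a s t (\<mu>, \<sigma>) x
      = (L powr (a - 1) * L powr (a - 1) * L powr (1 - 2 * a)) * (scale \<sigma>)\<^sup>2 * (score q s ?y * score q t ?y)
        * (p powr q * (q * p powr (q - 1) * L - (1 - a)))"
    unfolding g_integrand_def pd p_def[symmetric] dd by (simp add: power2_eq_square mult_ac)
  also have "\<dots> = (scale \<sigma>)\<^sup>2 * (score q s ?y * score q t ?y)
        * (p powr q / L * (q * p powr (q - 1) * L - (1 - a)))"
    unfolding pow by simp
  also have "p powr q / L * (q * p powr (q - 1) * L - (1 - a)) = (Z * \<sigma>) powr (1 - 2 * q) * weight \<sigma> ?y"
    using metric_weight[OF assms, of ?y] neg_ln_q_q_gaussian(2)[OF S(1), of \<mu> x]
    by (simp add: L_def p_def q_gaussian_eq)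
  also have "(scale \<sigma>)\<^sup>2 * (score q s ?y * score q t ?y) * ((Z * \<sigma>) powr (1 - 2 * q) * weight \<sigma> ?y)
      = ((scale \<sigma>)\<^sup>2 * (Z * \<sigma>) powr (1 - 2 * q)) * (score q s ?y * score q t ?y * weight \<sigma> ?y)"
    by (simp add: mult_ac)
  also have "(scale \<sigma>)\<^sup>2 * (Z * \<sigma>) powr (1 - 2 * q) = 1 / (Z * \<sigma> ^ 3)"
  proof -
    have "(scale \<sigma>)\<^sup>2 * (Z * \<sigma>) powr (1 - 2 * q)
        = (Z powr (q - 1) * Z powr (q - 1) * Z powr (1 - 2 * q))
          * (\<sigma> powr (q - 2) * \<sigma> powr (q - 2) * \<sigma> powr (1 - 2 * q))"
      using S Z_pos by (simp add: scale_def power2_eq_square powr_mult mult_ac)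
    also have "\<dots> = Z powr (- 1) * \<sigma> powr (- 3)" by (simp flip: powr_add)
    finally show ?thesis using S Z_pos by (simp add: powr_minus_divide)
  qed
  finally show ?thesis .
qed

section \<open>Integrability and smoothness of the coefficients\<close>

lemma abs_score_le: "\<bar>score q s y\<bar> \<le> max 1 (2 / (3 - q)) * (1 + y\<^sup>2)"
proof -
  \<comment> \<open>Completing the square even gives the bound
    \<open>y\<^sup>2 + 1 / 4\<close>.\<close>
  have b: "\<bar>y\<bar> \<le> 1 + y\<^sup>2"
    using zero_le_power2[of "\<bar>y\<bar> - 1 / 2"] by (simp add: power2_eq_square algebra_simps)
  show ?thesis
  proof (cases s)
    case Mu
    have "\<bar>score q s y\<bar> = 2 / (3 - q) * \<bar>y\<bar>" using Mu q by (simp add: abs_mult)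
    also have "\<dots> \<le> max 1 (2 / (3 - q)) * (1 + y\<^sup>2)"
      using b q by (intro mult_mono) auto
    finally show ?thesis .
  next
    case Sg
    have "\<bar>score q s y\<bar> \<le> 1 * (1 + y\<^sup>2)" using Sg by (auto simp: abs_le_iff)
    also have "\<dots> \<le> max 1 (2 / (3 - q)) * (1 + y\<^sup>2)"
      by (intro mult_right_mono) auto
    finally show ?thesis .
  qed
qed

lemma measurable_score [measurable]: "score q s \<in> borel_measurable borel"
proof -
  have "continuous_on UNIV (score q s)"
    using q by (cases s) (auto intro!: continuous_intros cong: continuous_on_cong)
  then show ?thesis by (rule borel_measurable_continuous_onI)
qed

lemma abs_score_mult_le:
  "\<bar>score q s y * score q t y\<bar> \<le> (max 1 (2 / (3 - q)))\<^sup>2 * (1 + y\<^sup>2)\<^sup>2"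
proof -
  have "\<bar>score q s y\<bar> * \<bar>score q t y\<bar>
      \<le> (max 1 (2 / (3 - q)) * (1 + y\<^sup>2)) * (max 1 (2 / (3 - q)) * (1 + y\<^sup>2))"
    by (intro mult_mono abs_score_le) auto
  then show ?thesis by (simp add: abs_mult power2_eq_square mult_ac)
qed

lemma integrable_score_powr:
  "integrable lborel (\<lambda>y. score q s y * score q t y * std_gauss y powr (2 * q - 1))"
proof -
  let ?C = "(max 1 (2 / (3 - q)))\<^sup>2"
  have "integrable lborel (\<lambda>y. ?C * (std_gauss y powr (2 * q - 1) * (1 + y\<^sup>2)\<^sup>2))"
    unfolding std_gauss_def using q
    by (intro integrable_mult_right integrable_exp_q_quadratic_powr2) auto
  then show ?thesis
  proof (rule Bochner_Integration.integrable_bound)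
    have "\<bar>score q s y * score q t y\<bar> * std_gauss y powr (2 * q - 1)
        \<le> (?C * (1 + y\<^sup>2)\<^sup>2) * std_gauss y powr (2 * q - 1)" for y
      using abs_score_mult_le by (intro mult_right_mono) auto
    then show "AE y in lborel. norm (score q s y * score q t y * std_gauss y powr (2 * q - 1))
        \<le> norm (?C * (std_gauss y powr (2 * q - 1) * (1 + y\<^sup>2)\<^sup>2))"
      by (intro AE_I2) (simp add: abs_mult mult_ac)
  qed measurable
qed

lemma integrable_score_stieltjes:
  "integrable lborel (\<lambda>y. score q s y * score q t y * std_gauss y powr q / (1 + y\<^sup>2))"
proof -
  let ?C = "(max 1 (2 / (3 - q)))\<^sup>2"
  have "integrable lborel (\<lambda>y. ?C * (std_gauss y powr q * (1 + y\<^sup>2)))"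
    unfolding std_gauss_def using q
    by (intro integrable_mult_right integrable_exp_q_quadratic_powr) auto
  then show ?thesis
  proof (rule Bochner_Integration.integrable_bound)
    have "\<bar>score q s y * score q t y * std_gauss y powr q / (1 + y\<^sup>2)\<bar>
        \<le> ?C * (std_gauss y powr q * (1 + y\<^sup>2))" for y
    proof -
      have y: "1 + y\<^sup>2 > 0" by (simp add: add_pos_nonneg)
      have "\<bar>score q s y * score q t y\<bar> * std_gauss y powr q
        \<le> (?C * (1 + y\<^sup>2)\<^sup>2) * std_gauss y powr q"
        using abs_score_mult_le by (intro mult_right_mono) auto
      then have "\<bar>score q s y * score q t y\<bar> * std_gauss y powr q / (1 + y\<^sup>2)
        \<le> (?C * (1 + y\<^sup>2)\<^sup>2) * std_gauss y powr q / (1 + y\<^sup>2)"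
        using y by (intro divide_right_mono) auto
      then show ?thesis using y by (simp add: abs_mult power2_eq_square mult_ac)
    qed
    then show "AE y in lborel. norm (score q s y * score q t y * std_gauss y powr q / (1 + y\<^sup>2))
        \<le> norm (?C * (std_gauss y powr q * (1 + y\<^sup>2)))"
      by (intro AE_I2) (simp add: order_trans[OF _ abs_ge_self])
  qed measurable
qed

definition coeff :: "coord \<Rightarrow> coord \<Rightarrow> real \<Rightarrow> real" where
  "coeff s t \<sigma> = (LINT y|lborel. score q s y * score q t y * weight \<sigma> y)"

text \<open>The exponent \<open>Suc 0\<close> is written out so that the last term matches the
  Stieltjes lemmas at \<open>n = 0\<close>.\<close>

lemma score_weight_eq:
  "score q s y * score q t y * weight \<sigma> y
    = q * (score q s y * score q t y * std_gauss y powr (2 * q - 1))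
      - (1 - a) * (3 - q) * (score q s y * score q t y * std_gauss y powr q / (shape \<sigma> + y\<^sup>2) ^ Suc 0)"
  by (simp add: weight_def algebra_simps)

lemma integrable_score_weight:
  assumes "\<sigma> \<in> Sigma_qa q a"
  shows "integrable lborel (\<lambda>y. score q s y * score q t y * weight \<sigma> y)"
  unfolding score_weight_eq
  using integrable_score_powr integrable_stieltjes[OF integrable_score_stieltjes shape_pos[OF assms]]
  by (intro Bochner_Integration.integrable_diff integrable_mult_right)

lemma coeff_eq:
  assumes "\<sigma> \<in> Sigma_qa q a"
  shows "coeff s t \<sigma> = q * (LINT y|lborel. score q s y * score q t y * std_gauss y powr (2 * q - 1))
      - (1 - a) * (3 - q) * (LINT y|lborel. score q s y * score q t y * std_gauss y powr q / (shape \<sigma> + y\<^sup>2) ^ Suc 0)"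
proof -
  note i = integrable_score_powr[of s t]
    integrable_stieltjes[OF integrable_score_stieltjes[of s t] shape_pos[OF assms], of 0]
  show ?thesis
    unfolding coeff_def score_weight_eq
    by (subst Bochner_Integration.integral_diff[OF integrable_mult_right[OF i(1)] integrable_mult_right[OF i(2)]])
       (simp only: integral_mult_right_zero)
qed

text \<open>The coefficient is a constant plus a multiple of a Stieltjes transform evaluated at
  \<open>shape \<sigma>\<close>, so smoothness follows by composition.\<close>

lemma Ck_real_coeff: "Ck_real k (Sigma_qa q a) (coeff s t)"
proof -
  have "Ck_real k {0<..} (ln_q q)"
  proof (cases k)
    case 0
    then show ?thesis
      using DERIV_ln_q by (auto intro!: continuous_at_imp_continuous_on DERIV_isCont)
  next
    case (Suc n)
    show ?thesis unfolding Suc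
      by (rule Ck_realI[OF DERIV_ln_q Ck_real_powr]) auto
  qed
  moreover have "Ck_real k (Sigma_qa q a) (\<lambda>\<sigma>. Z * \<sigma>)"
    by (rule Ck_real_mult[OF Ck_real_const Ck_real_ident])
  moreover have "(\<lambda>\<sigma>. Z * \<sigma>) ` Sigma_qa q a \<subseteq> {0<..}" using Sigma_qaD(3) by auto
  ultimately have "Ck_real k (Sigma_qa q a) (\<lambda>\<sigma>. ln_q q (Z * \<sigma>))"
    by (metis Ck_real_compose)
  then have shape: "Ck_real k (Sigma_qa q a) shape"
    unfolding shape_def[abs_def] by (rule Ck_real_mult[OF Ck_real_const])
  define M where "M = (LINT y|lborel. score q s y * score q t y * std_gauss y powr (2 * q - 1))"
  define N where
    "N r = (LINT y|lborel. score q s y * score q t y * std_gauss y powr q / (r + y\<^sup>2) ^ Suc 0)" for r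
  have "Ck_real k {0<..} N"
    unfolding N_def[abs_def] by (rule Ck_real_stieltjes[OF integrable_score_stieltjes])
  moreover have "shape ` Sigma_qa q a \<subseteq> {0<..}" using shape_pos by auto
  ultimately have "Ck_real k (Sigma_qa q a) (\<lambda>\<sigma>. N (shape \<sigma>))"
    using Ck_real_compose shape by blast
  then have "Ck_real k (Sigma_qa q a) (\<lambda>\<sigma>. q * M + - ((1 - a) * (3 - q)) * N (shape \<sigma>))"
    by (intro Ck_real_add[OF Ck_real_const] Ck_real_mult[OF Ck_real_const])
  then show ?thesis
    by (rule Ck_real_cong[OF open_Sigma_qa, rotated]) (simp add: coeff_eq M_def N_def)
qed

lemma integrable_g_integrand:
  assumes "\<sigma> \<in> Sigma_qa q a"
  shows "integrable lborel (g_integrand q a s t (\<mu>, \<sigma>))"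
proof -
  have \<sigma>: "\<sigma> > 0" by (rule Sigma_qaD[OF assms])
  have "integrable lborel (\<lambda>x. 1 / (Z * \<sigma> ^ 3) * (score q s (- \<mu> / \<sigma> + 1 / \<sigma> * x)
      * score q t (- \<mu> / \<sigma> + 1 / \<sigma> * x) * weight \<sigma> (- \<mu> / \<sigma> + 1 / \<sigma> * x)))"
    using lborel_integrable_real_affine[OF integrable_score_weight[OF assms, of s t], of "1 / \<sigma>" "- \<mu> / \<sigma>"] \<sigma>
    by (intro integrable_mult_right) auto
  moreover have "- \<mu> / \<sigma> + 1 / \<sigma> * x = (x - \<mu>) / \<sigma>" for x by (simp add: diff_divide_distrib)
  ultimately show ?thesis
    by (simp add: g_integrand_eq[OF assms, abs_def])
qed

text \<open>Substituting \<open>y = (x - \<mu>) / \<sigma>\<close> removes \<open>\<mu>\<close>, and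
  the Jacobian \<open>\<sigma>\<close> lowers the cube in the integrand to a square.\<close>

lemma g_qa_eq:
  assumes "\<sigma> \<in> Sigma_qa q a"
  shows "g_qa q a s t (\<mu>, \<sigma>) = 1 / (Z * \<sigma>\<^sup>2) * coeff s t \<sigma>"
proof -
  have \<sigma>: "\<sigma> > 0" by (rule Sigma_qaD[OF assms])
  have y: "- \<mu> / \<sigma> + 1 / \<sigma> * x = (x - \<mu>) / \<sigma>" for x by (simp add: diff_divide_distrib)
  have "coeff s t \<sigma> = 1 / \<sigma> * (LINT x|lborel. score q s ((x - \<mu>) / \<sigma>) * score q t ((x - \<mu>) / \<sigma>) * weight \<sigma> ((x - \<mu>) / \<sigma>))"
    unfolding coeff_def
    using lborel_integral_real_affine[of "1 / \<sigma>" "\<lambda>y. score q s y * score q t y * weight \<sigma> y" "- \<mu> / \<sigma>"] \<sigma>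
    by (simp add: y[simplified])
  then show ?thesis
    using \<sigma> Z_pos unfolding g_qa_def g_integrand_eq[OF assms]
    by (simp add: power2_eq_square power3_eq_cube)
qed

section \<open>Symmetry and positive definiteness\<close>

lemma coeff_commute: "coeff s t = coeff t s"
  by (simp add: coeff_def fun_eq_iff mult.commute)

text \<open>The quadratic form is the integral of the squared combination of the scores against the
  positive weight. That combination is a nonzero polynomial, so the integrand has finitely many
  zeros.\<close>

lemma coeff_pos_def:
  assumes \<sigma>: "\<sigma> \<in> Sigma_qa q a" and v: "v \<noteq> (0, 0)"
  shows "0 < fst v * fst v * coeff Mu Mu \<sigma> + fst v * snd v * coeff Mu Sg \<sigma>
    + snd v * fst v * coeff Sg Mu \<sigma> + snd v * snd v * coeff Sg Sg \<sigma>"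
proof -
  obtain v1 v2 where [simp]: "v = (v1, v2)" by (cases v)
  let ?f = "\<lambda>y. (v1 * score q Mu y + v2 * score q Sg y)\<^sup>2 * weight \<sigma> y"
  let ?i = "\<lambda>s t y. score q s y * score q t y * weight \<sigma> y"
  note i = integrable_score_weight[OF \<sigma>]
  have f: "?f = (\<lambda>y. v1 * v1 * ?i Mu Mu y + v1 * v2 * ?i Mu Sg y + v2 * v1 * ?i Sg Mu y + v2 * v2 * ?i Sg Sg y)"
    by (simp add: fun_eq_iff power2_eq_square algebra_simps del: score.simps)
  have int: "integrable lborel ?f"
    unfolding f by (intro Bochner_Integration.integrable_add integrable_mult_right i)
  have "0 < (LINT y|lborel. ?f y)"
  proof (rule integral_pos_finite_zeros[OF int])
    show "0 \<le> ?f y" for y using weight_pos[OF \<sigma>, of y] by simp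
    let ?p = "[:v2, - 2 * v1 / (3 - q), - v2:]"
    have "?f y = 0 \<longleftrightarrow> poly ?p y = 0" for y
    proof -
      have "v1 * score q Mu y + v2 * score q Sg y = poly ?p y"
        by (simp add: algebra_simps power2_eq_square)
      then show ?thesis
        using weight_pos[OF \<sigma>, of y] by (simp del: score.simps poly_pCons)
    qed
    moreover have "?p \<noteq> 0" using v q by auto
    ultimately show "finite {y. ?f y = 0}" using poly_roots_finite[of ?p] by simp
  qed
  also have "(LINT y|lborel. ?f y) = v1 * v1 * coeff Mu Mu \<sigma> + v1 * v2 * coeff Mu Sg \<sigma>
    + v2 * v1 * coeff Sg Mu \<sigma> + v2 * v2 * coeff Sg Sg \<sigma>"
    unfolding f coeff_def
    by (simp only: Bochner_Integration.integral_add Bochner_Integration.integrable_add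
        integrable_mult_right i integral_mult_right_zero)
  finally show ?thesis by simp
qed

section \<open>The global chart and the metric in it\<close>

lemma inj_on_q_gaussian: "inj_on (q_gaussian q) (param_qa q a)"
proof (rule inj_onI)
  fix \<xi> \<eta> assume "\<xi> \<in> param_qa q a" "\<eta> \<in> param_qa q a" and eq: "q_gaussian q \<xi> = q_gaussian q \<eta>"
  then obtain \<mu> \<sigma> m s where \<xi>: "\<xi> = (\<mu>, \<sigma>)" "\<eta> = (m, s)" and S: "\<sigma> \<in> Sigma_qa q a" "s \<in> Sigma_qa q a"
    by (auto simp: param_qa_def)
  note pos = Sigma_qaD[OF S(1)] Sigma_qaD[OF S(2)]
  have e: "1 / (Z * \<sigma>) * std_gauss ((x - \<mu>) / \<sigma>) = 1 / (Z * s) * std_gauss ((x - m) / s)" for x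
    using fun_cong[OF eq, of x] by (simp add: \<xi> q_gaussian_eq)
  have le: "1 / (Z * s) * std_gauss y \<le> 1 / (Z * s)" "1 / (Z * \<sigma>) * std_gauss y \<le> 1 / (Z * \<sigma>)" for y
    using pos std_gauss_le_1[of y] mult_left_mono[of "std_gauss y" 1 "1 / (Z * s)"]
      mult_left_mono[of "std_gauss y" 1 "1 / (Z * \<sigma>)"] by auto
  \<comment> \<open>Each density is evaluated at its own mean, where it attains its maximum. Equal
    maxima give equal \<open>\<sigma>\<close>, and the profile takes the value 1 only at 0, which
    then gives equal means.\<close>
  have "1 / (Z * \<sigma>) \<le> 1 / (Z * s)" using e[of \<mu>] le(1)[of "(\<mu> - m) / s"] by simp
  moreover have "1 / (Z * s) \<le> 1 / (Z * \<sigma>)" using e[of m] le(2)[of "(m - \<mu>) / \<sigma>"] by simp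
  ultimately have "1 / (Z * \<sigma>) = 1 / (Z * s)" by simp
  then have \<sigma>: "\<sigma> = s" using pos Z_pos by (simp add: field_simps)
  then have "std_gauss ((\<mu> - m) / s) = 1" using e[of \<mu>] pos Z_pos by (simp add: field_simps)
  from std_gauss_eq_1[OF this] show "\<xi> = \<eta>" using pos \<sigma> by (simp add: \<xi>)
qed

text \<open>The chart is inverted to read off the parameters of a density. The restriction to
  \<open>S_qa q a\<close> makes the function extensional, without which uniqueness would fail off
  the manifold.\<close>

definition metric :: "(real \<Rightarrow> real) \<Rightarrow> real \<times> real \<Rightarrow> real \<times> real \<Rightarrow> real" where
  "metric = (\<lambda>p\<in>S_qa q a. \<lambda>v w. let g = (\<lambda>s t. g_qa q a s t (the_inv_into (param_qa q a) (q_gaussian q) p)) in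
     fst v * fst w * g Mu Mu + fst v * snd w * g Mu Sg + snd v * fst w * g Sg Mu + snd v * snd w * g Sg Sg)"

lemma metric_eq:
  assumes "\<sigma> \<in> Sigma_qa q a"
  shows "metric (q_gaussian q (\<mu>, \<sigma>)) v w = 1 / (Z * \<sigma>\<^sup>2) * (fst v * fst w * coeff Mu Mu \<sigma>
    + fst v * snd w * coeff Mu Sg \<sigma> + snd v * fst w * coeff Sg Mu \<sigma> + snd v * snd w * coeff Sg Sg \<sigma>)"
proof -
  have "(\<mu>, \<sigma>) \<in> param_qa q a" using assms by (simp add: param_qa_def)
  then have "q_gaussian q (\<mu>, \<sigma>) \<in> S_qa q a"
    "the_inv_into (param_qa q a) (q_gaussian q) (q_gaussian q (\<mu>, \<sigma>)) = (\<mu>, \<sigma>)"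
    by (auto simp: S_qa_def the_inv_into_f_f[OF inj_on_q_gaussian])
  then show ?thesis
    by (simp add: metric_def Let_def g_qa_eq[OF assms] add_divide_distrib)
qed

lemma riemannian_metric_metric: "riemannian_metric (param_qa q a) (q_gaussian q) metric"
  unfolding riemannian_metric_def
proof (intro conjI ballI allI impI)
  show U: "open (param_qa q a)"
    by (simp add: param_qa_def open_Times open_Sigma_qa)
  show "inj_on (q_gaussian q) (param_qa q a)" by (rule inj_on_q_gaussian)
  show "smooth_on (param_qa q a) (\<lambda>\<xi>. metric (q_gaussian q \<xi>) v w)" for v w
    unfolding smooth_on_def
  proof
    fix k
    \<comment> \<open>The factor \<open>1 / \<sigma>\<^sup>2\<close> is written as a real power so
      that \<open>Ck_real_powr\<close> applies.\<close>
    let ?h = "\<lambda>\<sigma>. \<sigma> powr (- 2) * (1 / Z) * (fst v * fst w * coeff Mu Mu \<sigma>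
      + fst v * snd w * coeff Mu Sg \<sigma> + snd v * fst w * coeff Sg Mu \<sigma> + snd v * snd w * coeff Sg Sg \<sigma>)"
    have "Ck_real k (Sigma_qa q a) (\<lambda>\<sigma>. \<sigma> powr (- 2))"
      using Sigma_qaD(1)
      by (intro Ck_real_compose[OF _ Ck_real_powr Ck_real_ident]) auto
    then have "Ck_real k (Sigma_qa q a) ?h"
      by (intro Ck_real_mult Ck_real_add Ck_real_const Ck_real_coeff)
    moreover have "s powr (- 2) = 1 / s\<^sup>2" if "s > 0" for s :: real
      using powr_minus_divide[of s 2] that by simp
    ultimately show "Ck_on k (param_qa q a) (\<lambda>\<xi>. metric (q_gaussian q \<xi>) v w)"
      unfolding param_qa_def
      by - (rule Ck_on_cong[OF U[unfolded param_qa_def] _ Ck_on_snd[OF open_Sigma_qa, of k ?h 1]],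
        auto simp: metric_eq Sigma_qaD(1))
  qed
next
  fix p assume "p \<in> q_gaussian q ` param_qa q a"
  then obtain \<mu> \<sigma> where p: "p = q_gaussian q (\<mu>, \<sigma>)" and \<sigma>: "\<sigma> \<in> Sigma_qa q a"
    by (auto simp: param_qa_def)
  show "bilinear (metric p)"
    unfolding bilinear_def p
    by (intro conjI allI linearI; simp add: metric_eq[OF \<sigma>] algebra_simps add_divide_distrib)
  show "metric p v w = metric p w v" for v w
    by (simp add: p metric_eq[OF \<sigma>] coeff_commute[of Sg Mu] algebra_simps)
  show "0 < metric p v v" if "v \<noteq> 0" for v
    using coeff_pos_def[OF \<sigma>, of v] that Sigma_qaD(1)[OF \<sigma>] Z_pos
    by (simp add: p metric_eq[OF \<sigma>] zero_prod_def)
qed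

lemma metric_coord:
  assumes "\<xi> \<in> param_qa q a"
  shows "metric (q_gaussian q \<xi>) (coord_field s) (coord_field t) = g_qa q a s t \<xi>"
proof -
  obtain \<mu> \<sigma> where "\<xi> = (\<mu>, \<sigma>)" "\<sigma> \<in> Sigma_qa q a" using assms by (auto simp: param_qa_def)
  then show ?thesis by (cases s; cases t) (simp_all add: metric_eq g_qa_eq)
qed

text \<open>On the manifold two bilinear forms agree once they agree on the coordinate fields;
  elsewhere extensionality fixes both.\<close>

lemma metric_unique:
  assumes G_ext: "G \<in> extensional (S_qa q a)"
    and G: "riemannian_metric (param_qa q a) (q_gaussian q) G"
    and coord: "\<forall>\<xi>\<in>param_qa q a. \<forall>s t.
           G (q_gaussian q \<xi>) (coord_field s) (coord_field t) = g_qa q a s t \<xi>"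
  shows "G = metric"
proof (rule extensionalityI[OF G_ext])
  show "metric \<in> extensional (S_qa q a)" by (simp add: metric_def)
  fix p assume "p \<in> S_qa q a"
  then obtain \<xi> where p: "p = q_gaussian q \<xi>" and \<xi>: "\<xi> \<in> param_qa q a" by (auto simp: S_qa_def)
  have b: "bilinear (G p)" "bilinear (metric p)"
    using G riemannian_metric_metric \<xi> by (auto simp: riemannian_metric_def p)
  have "G p (coord_field s) (coord_field t) = metric p (coord_field s) (coord_field t)" for s t
    using coord metric_coord \<xi> by (simp add: p)
  from this[of Mu Mu] this[of Mu Sg] this[of Sg Mu] this[of Sg Sg]
  have "G p v w = metric p v w" for v w
    using bilinear_expand_coord[OF b(1), of v w] bilinear_expand_coord[OF b(2), of v w] by simp
  then show "G p = metric p" by (intro ext)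
qed

end

theorem theorem2:
  fixes q a :: real
  assumes "1 \<le> q" and "q < 3" and "a \<noteq> 0"
    and "q = 1 \<or> (q > 1 \<and> 1 - a < q / (q - 1))"
  shows
    \<comment> \<open>all expressions entering the coefficients are well defined\<close>
    "(\<forall>\<xi>\<in>param_qa q a. \<forall>x. q_gaussian q \<xi> x \<in> {0<..<1}) \<and>
     (\<forall>\<xi>\<in>param_qa q a. \<forall>x. \<forall>s.
        partial_differentiable s (\<lambda>\<eta>. ln_qa q a (q_gaussian q \<eta> x)) \<xi>) \<and>
     (\<forall>u\<in>ln_qa q a ` {0<..<1}. exp_qa q a field_differentiable at u \<and>
        deriv (exp_qa q a) field_differentiable at u) \<and>
     (\<forall>\<xi>\<in>param_qa q a. \<forall>s t. integrable lborel (g_integrand q a s t \<xi>)) \<and>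
     (\<exists>!G. G \<in> extensional (S_qa q a) \<and>
        riemannian_metric (param_qa q a) (q_gaussian q) G \<and>
        (\<forall>\<xi>\<in>param_qa q a. \<forall>s t.
           G (q_gaussian q \<xi>) (coord_field s) (coord_field t) = g_qa q a s t \<xi>))"
proof -
  interpret q_gaussian_family q a
    using assms by unfold_locales
  have diff: "partial_differentiable s (\<lambda>\<eta>. ln_qa q a (q_gaussian q \<eta> x)) \<xi>"
    if \<xi>: "\<xi> \<in> param_qa q a" for \<xi> x s
  proof -
    obtain \<mu> \<sigma> where "\<xi> = (\<mu>, \<sigma>)" "\<sigma> \<in> Sigma_qa q a"
      using \<xi> by (auto simp: param_qa_def)
    then show ?thesis
      unfolding partial_differentiable_def field_differentiable_def
      using DERIV_ln_qa_q_gaussian by blast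
  qed
  have exp: "exp_qa q a field_differentiable at u \<and> deriv (exp_qa q a) field_differentiable at u"
    if "u \<in> ln_qa q a ` {0<..<1}" for u
  proof -
    have "a * u < 0" using that ln_qa_range[OF \<open>a \<noteq> 0\<close>] by auto
    from DERIV_exp_qa[OF \<open>1 \<le> q\<close> \<open>a \<noteq> 0\<close> this] show ?thesis
      unfolding field_differentiable_def by blast
  qed
  have metric: "\<exists>!G. G \<in> extensional (S_qa q a) \<and>
        riemannian_metric (param_qa q a) (q_gaussian q) G \<and>
        (\<forall>\<xi>\<in>param_qa q a. \<forall>s t.
           G (q_gaussian q \<xi>) (coord_field s) (coord_field t) = g_qa q a s t \<xi>)"
  proof (rule ex1I[of _ metric])
    show "metric \<in> extensional (S_qa q a) \<and> riemannian_metric (param_qa q a) (q_gaussian q) metric \<and>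
        (\<forall>\<xi>\<in>param_qa q a. \<forall>s t.
           metric (q_gaussian q \<xi>) (coord_field s) (coord_field t) = g_qa q a s t \<xi>)"
      using metric_coord riemannian_metric_metric by (simp add: metric_def)
  qed (use metric_unique in blast)
  have bounds: "q_gaussian q \<xi> x \<in> {0<..<1}" "integrable lborel (g_integrand q a s t \<xi>)"
    if "\<xi> \<in> param_qa q a" for \<xi> x s t
    using that q_gaussian_bounds(1,3) integrable_g_integrand by (auto simp: param_qa_def)
  show ?thesis
    by (intro conjI ballI allI bounds diff metric; (rule exp[THEN conjunct1] exp[THEN conjunct2])?)
qed

end
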